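(* Let $N\ge 2$, $j\ge 2$ and $1\le m\le N-1$ be integers, let $u=(1/N,\dots,1/N)$, and let $p=(p_1,\dots,p_N)$ be a probability vector with all $p_i>0$ and $p\ne u$. Then the map $$\theta\mapsto C_m^{(j)}(u+\theta(p-u))$$ is strictly decreasing on $(0,1]$.
   Context: Siblings coupon-collector model: for a probability vector $p=(p_1,\dots,p_N)$ with all $p_i>0$, coupons with types in $\{1,\dots,N\}$ are sampled independently with replacement, each having type $i$ with probability $p_i$. The main collector stops at the first time $\tau$ at which all $N$ types have appeared at least once (almost surely finite). Duplicates are passed to the next collector (sibling); if that collector already has that type, the coupon is passed to the next sibling, and so on. $U_j^N$ is the number of empty spaces in the $j$th collector's album at time $\tau$ (the main collector being the first collector); equivalently, $U_j^N$ is the number of coupon types whose total count among the first $\tau$ coupons is less than $j$. $\mathbb E_p$ denotes expectation when the coupon-type law is $p$. For $0\le m\le N-1$, define $$C_m^{(j)}(p):=\mathbb E_p\binom{U_j^N-1}{m}.$$ (For $j\ge2$ one has $U_j^N\ge 1$ because the last coupon type to appear has count exactly one at time $\tau$.) *)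

theory Defs
  imports "HOL-Probability.Probability"
begin

text \<open>
  The coupon types are the elements of a finite type \<open>'n\<close>, so \<open>N = CARD('n)\<close>. A sample point
  \<open>\<omega> :: nat \<Rightarrow> 'n\<close> is the sequence of coupons drawn; the coupons are numbered from \<open>0\<close>, so that
  \<open>\<omega> 0, \<dots>, \<omega> (t - 1)\<close> are the first \<open>t\<close> of them.
\<close>

definition prob_vec :: "real ^ 'n \<Rightarrow> bool" where
  "prob_vec p \<longleftrightarrow> (\<forall>i. 0 \<le> p $ i) \<and> (\<Sum>i\<in>UNIV. p $ i) = 1"

definition uniform_vec :: "real ^ 'n" where
  "uniform_vec = (\<chi> i. 1 / real CARD('n))"

text \<open>The law of one coupon; meaningful only if \<open>prob_vec p\<close>.\<close>

definition coupon_pmf :: "real ^ 'n \<Rightarrow> 'n pmf" where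
  "coupon_pmf p = embed_pmf (\<lambda>i. p $ i)"

definition coupon_space :: "real ^ 'n \<Rightarrow> (nat \<Rightarrow> 'n) measure" where
  "coupon_space p = Pi\<^sub>M UNIV (\<lambda>_. measure_pmf (coupon_pmf p))"

text \<open>
  \<open>albums \<omega> t k\<close> is the content of the album of collector \<open>k\<close> after \<open>t\<close> coupons. Collectors are
  numbered from \<open>1\<close> (the main collector); index \<open>0\<close> is unused. A coupon goes to the first
  collector who lacks its type.
\<close>

primrec albums :: "(nat \<Rightarrow> 'n) \<Rightarrow> nat \<Rightarrow> nat \<Rightarrow> 'n set" where
  "albums \<omega> 0 = (\<lambda>k. {})"
| "albums \<omega> (Suc t) =
     (let k = (LEAST k. 1 \<le> k \<and> \<omega> t \<notin> albums \<omega> t k)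
      in (albums \<omega> t)(k := insert (\<omega> t) (albums \<omega> t k)))"

text \<open>The value is arbitrary on the null set where some type never appears.\<close>

definition stop_time :: "(nat \<Rightarrow> 'n) \<Rightarrow> nat" where
  "stop_time \<omega> = (LEAST t. \<omega> ` {..<t} = UNIV)"

definition empty_spaces :: "nat \<Rightarrow> (nat \<Rightarrow> 'n) \<Rightarrow> nat" where
  "empty_spaces j \<omega> = card (- albums \<omega> (stop_time \<omega>) j)"

text \<open>
  For \<open>j \<ge> 2\<close> the natural-number subtraction does not truncate outside a null set: see
  \<open>empty_spaces_pos\<close> below.
\<close>

definition C_coef :: "nat \<Rightarrow> nat \<Rightarrow> real ^ 'n \<Rightarrow> real" where
  "C_coef m j p = (\<integral>\<omega>. real ((empty_spaces j \<omega> - 1) choose m) \<partial>coupon_space p)"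

lemma pmf_coupon_pmf:
  assumes "prob_vec p"
  shows "pmf (coupon_pmf p) i = p $ i"
  unfolding coupon_pmf_def
proof (rule pmf_embed_pmf)
  show "0 \<le> p $ x" for x
    using assms by (simp add: prob_vec_def)
  have "(\<integral>\<^sup>+x. ennreal (p $ x) \<partial>count_space UNIV) = (\<Sum>x\<in>UNIV. ennreal (p $ x))"
    by (simp add: nn_integral_count_space_finite)
  also have "\<dots> = ennreal (\<Sum>x\<in>UNIV. p $ x)"
    using assms by (intro sum_ennreal) (simp add: prob_vec_def)
  finally show "(\<integral>\<^sup>+x. ennreal (p $ x) \<partial>count_space UNIV) = 1"
    using assms by (simp add: prob_vec_def)
qed

lemma mem_albums_iff:
  assumes "1 \<le> k"
  shows "c \<in> albums \<omega> t k \<longleftrightarrow> k \<le> card {s. s < t \<and> \<omega> s = c}"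
  using assms
proof (induction t arbitrary: c k)
  case 0
  then show ?case by simp
next
  case (Suc t)
  define n where "n = (\<lambda>c. card {s. s < t \<and> \<omega> s = c})"
  have L: "(LEAST k. 1 \<le> k \<and> \<omega> t \<notin> albums \<omega> t k) = Suc (n (\<omega> t))"
  proof (rule Least_equality)
    show "1 \<le> Suc (n (\<omega> t)) \<and> \<omega> t \<notin> albums \<omega> t (Suc (n (\<omega> t)))"
      using Suc.IH[of "Suc (n (\<omega> t))" "\<omega> t"] by (simp add: n_def)
    show "Suc (n (\<omega> t)) \<le> y" if "1 \<le> y \<and> \<omega> t \<notin> albums \<omega> t y" for y
      using Suc.IH[of y "\<omega> t"] that by (simp add: n_def)
  qed
  have step: "card {s. s < Suc t \<and> \<omega> s = c} = (if c = \<omega> t then Suc (n c) else n c)"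
  proof (cases "c = \<omega> t")
    case True
    then have "{s. s < Suc t \<and> \<omega> s = c} = insert t {s. s < t \<and> \<omega> s = c}"
      by (auto simp: less_Suc_eq)
    then show ?thesis using True by (simp add: n_def)
  next
    case False
    then have "{s. s < Suc t \<and> \<omega> s = c} = {s. s < t \<and> \<omega> s = c}"
      by (auto simp: less_Suc_eq)
    then show ?thesis using False by (simp add: n_def)
  qed
  have alb: "albums \<omega> (Suc t) k =
      (if k = Suc (n (\<omega> t)) then insert (\<omega> t) (albums \<omega> t k) else albums \<omega> t k)"
    using L by (simp add: Let_def)
  have "c \<in> albums \<omega> (Suc t) k \<longleftrightarrow> (k = Suc (n (\<omega> t)) \<and> c = \<omega> t) \<or> k \<le> n c"
    unfolding alb using Suc.IH[of k c] Suc.prems by (auto simp: n_def)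
  then show ?case
    unfolding step by auto
qed

lemma empty_spaces_eq_card:
  assumes "1 \<le> j"
  shows "empty_spaces j \<omega> = card {c. card {s. s < stop_time \<omega> \<and> \<omega> s = c} < j}"
  unfolding empty_spaces_def
  by (rule arg_cong[where f = card]) (auto simp: mem_albums_iff[OF assms] not_le)

lemma empty_spaces_pos:
  fixes \<omega> :: "nat \<Rightarrow> 'n::finite"
  assumes "surj \<omega>" "2 \<le> j"
  shows "1 \<le> empty_spaces j \<omega>"
proof -
  define T where "T = stop_time \<omega>"
  have "\<exists>t. \<omega> ` {..<t} = UNIV"
  proof -
    have "\<omega> ` {..<Suc (Max (range (inv \<omega>)))} = UNIV"
    proof (intro set_eqI iffI UNIV_I)
      fix c
      have "inv \<omega> c \<le> Max (range (inv \<omega>))" by (intro Max_ge) auto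
      then show "c \<in> \<omega> ` {..<Suc (Max (range (inv \<omega>)))}"
        using assms(1) by (intro image_eqI[of _ _ "inv \<omega> c"]) (simp_all add: surj_f_inv_f less_Suc_eq_le)
    qed
    then show ?thesis by blast
  qed
  then have T: "\<omega> ` {..<T} = UNIV"
    unfolding T_def stop_time_def by (rule LeastI_ex)
  then obtain T' where T': "T = Suc T'"
    by (cases T) auto
  have "\<omega> ` {..<T'} \<noteq> UNIV"
    using not_less_Least[of T' "\<lambda>t. \<omega> ` {..<t} = UNIV"] T'
    unfolding T_def stop_time_def by simp
  then obtain c where c: "c \<notin> \<omega> ` {..<T'}" by blast
  have "{s. s < T \<and> \<omega> s = c} \<subseteq> {T'}"
    using c T' by (auto simp: less_Suc_eq)
  then have "card {s. s < T \<and> \<omega> s = c} \<le> card {T'}"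
    by (intro card_mono) auto
  then have "c \<in> {c. card {s. s < stop_time \<omega> \<and> \<omega> s = c} < j}"
    using assms(2) by (simp add: T_def)
  then have "0 < card {c. card {s. s < stop_time \<omega> \<and> \<omega> s = c} < j}"
    by (intro card_gt_0_iff[THEN iffD2]) auto
  then show ?thesis
    using assms(2) by (simp add: empty_spaces_eq_card)
qed

end

theory Submission
  imports Defs
begin

text \<open>
  Give the coupons arrival times from a Poisson process of any rate \<open>c > 0\<close>. Then the types are
  collected independently, type \<open>i\<close> at rate \<open>r i = c * p $ i\<close>, while the expectation is
  unchanged because only the order of the coupons matters. Summing over the set \<open>S\<close> of \<open>m\<close> types,
  other than the last one, that are counted by the binomial coefficient gives
  (\<open>integral_tendsto_C_coef\<close>)
  
  \<open>C_coef m j p = (\<Sum>S | card S = m. \<integral> A S * (d/dt) (B S) dt)\<close>, where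
  \<open>A S t = (\<Prod>i\<in>S. few j (r i * t))\<close> and \<open>B S t = (\<Prod>k\<in>-S. seen (r k * t))\<close>,
  
  and \<open>t\<close> ranges over the positive reals; here \<open>few j x\<close> and \<open>seen x\<close> are the probabilities
  that a Poisson variable of mean \<open>x\<close> lies in \<open>{1..<j}\<close> and is positive, respectively.
  
  The freedom in \<open>c\<close> turns the segment into a simple family. For \<open>c = 1 / \<theta>\<close> the rates of the vector
  \<open>u + \<theta> (p - u)\<close> are \<open>p $ i + s\<close> with \<open>s = (1 - \<theta>) / (\<theta> N)\<close>, so decreasing \<open>\<theta>\<close> means adding a
  larger constant to all rates, and the claim is that the integral strictly increases with \<open>s\<close>.
  
  Its derivative in \<open>s\<close> is, after an integration by parts, the integral of the Jacobians of \<open>A S\<close> and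
  \<open>B S\<close> with respect to \<open>(s, t)\<close>, up to a nonnegative boundary term
  (\<open>deriv_integral_product\<close>). In a Jacobian, types \<open>i\<in>S\<close> and \<open>k\<notin>S\<close> contribute with the factor
  \<open>t * (r k - r i)\<close>. Combined with the term in which \<open>i\<close> and \<open>k\<close> are exchanged this becomes
  \<open>(r k - r i) * (q (r i * t) - q (r k * t))\<close> times a positive factor, where
  \<open>q x = 1 - x ^ (j - 1) / fact (j - 1)\<close> is the quotient of the derivatives of \<open>few j\<close> and \<open>seen\<close>.
  As \<open>q\<close> decreases strictly, the sum is positive unless all rates agree (\<open>sum_minors_pos\<close>), which
  they do not, since \<open>p\<close> is not uniform.
\<close>

section \<open>Differentiating an integral of a 1-form\<close>

lemma continuous_on_slice:
  fixes f :: "real \<Rightarrow> real \<Rightarrow> real"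
  assumes "continuous_on UNIV (\<lambda>x. f (fst x) (snd x))"
  shows "continuous_on X (f s)"
proof -
  have "continuous_on X (\<lambda>t. (\<lambda>x. f (fst x) (snd x)) (s, t))"
    by (rule continuous_on_compose2[OF assms]) (auto intro!: continuous_intros)
  then show ?thesis by simp
qed

text \<open>
  Here \<open>Bs\<close> and \<open>Bt\<close> are the partial derivatives of a function \<open>B\<close> and \<open>Bst\<close> is its mixed one.
  Differentiating \<open>A * Bt\<close> in \<open>s\<close> gives \<open>As * Bt + A * Bst\<close>, and integrating \<open>A * Bst\<close> by parts
  in \<open>t\<close> removes the second derivative. This is Green's formula for the 1-form \<open>A dB\<close>, whose
  exterior derivative is the Jacobian \<open>As * Bt - At * Bs\<close>.
\<close>

lemma deriv_integral_product:
  fixes A As At Bs Bt Bst :: "real \<Rightarrow> real \<Rightarrow> real"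
  assumes As: "\<And>s t. ((\<lambda>s. A s t) has_field_derivative As s t) (at s)"
    and At: "\<And>s t. (A s has_field_derivative At s t) (at t)"
    and Bst: "\<And>s t. ((\<lambda>s. Bt s t) has_field_derivative Bst s t) (at s)"
    and Bts: "\<And>s t. (Bs s has_field_derivative Bst s t) (at t)"
    and cont: "continuous_on UNIV (\<lambda>x. A (fst x) (snd x))" "continuous_on UNIV (\<lambda>x. As (fst x) (snd x))"
      "continuous_on UNIV (\<lambda>x. At (fst x) (snd x))" "continuous_on UNIV (\<lambda>x. Bs (fst x) (snd x))"
      "continuous_on UNIV (\<lambda>x. Bt (fst x) (snd x))" "continuous_on UNIV (\<lambda>x. Bst (fst x) (snd x))"
    and T: "0 \<le> T"
  shows "((\<lambda>s. integral {0..T} (\<lambda>t. A s t * Bt s t)) has_field_derivative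
           A s T * Bs s T - A s 0 * Bs s 0 + integral {0..T} (\<lambda>t. As s t * Bt s t - At s t * Bs s t)) (at s)"
proof -
  note sl = cont[THEN continuous_on_slice]
  have "((\<lambda>s. integral (cbox 0 T) (\<lambda>t. A s t * Bt s t)) has_field_derivative
          integral (cbox 0 T) (\<lambda>t. As s t * Bt s t + A s t * Bst s t)) (at s within UNIV)"
  proof (rule leibniz_rule_field_derivative)
    show "((\<lambda>s. A s t * Bt s t) has_field_derivative As s t * Bt s t + A s t * Bst s t) (at s within UNIV)" for s t
      by (auto intro!: derivative_eq_intros As Bst)
    show "(\<lambda>t. A s t * Bt s t) integrable_on cbox 0 T" for s
      by (intro integrable_continuous continuous_intros sl)
    show "continuous_on (UNIV \<times> cbox 0 T) (\<lambda>(s, t). As s t * Bt s t + A s t * Bst s t)"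
      unfolding case_prod_unfold
      by (intro continuous_intros continuous_on_subset[OF cont(1)] continuous_on_subset[OF cont(2)]
          continuous_on_subset[OF cont(5)] continuous_on_subset[OF cont(6)]) auto
  qed auto
  moreover have parts: "((\<lambda>t. At s t * Bs s t + A s t * Bst s t) has_integral A s T * Bs s T - A s 0 * Bs s 0) {0..T}"
    using T
    by (intro fundamental_theorem_of_calculus)
       (auto simp flip: has_real_derivative_iff_has_vector_derivative
          intro!: derivative_eq_intros DERIV_subset[OF At] DERIV_subset[OF Bts])
  have "((\<lambda>t. As s t * Bt s t - At s t * Bs s t) has_integral
      integral {0..T} (\<lambda>t. As s t * Bt s t - At s t * Bs s t)) {0..T}"
    by (intro integrable_integral integrable_continuous_interval continuous_intros sl)
  from has_integral_add[OF parts this]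
  have "integral {0..T} (\<lambda>t. As s t * Bt s t + A s t * Bst s t)
      = A s T * Bs s T - A s 0 * Bs s 0 + integral {0..T} (\<lambda>t. As s t * Bt s t - At s t * Bs s t)"
    by (intro integral_unique) (simp add: algebra_simps)
  ultimately show ?thesis by simp
qed

section \<open>The probabilities of one Poisson count\<close>

text \<open>
  If the number of coupons of one type is Poisson distributed with mean \<open>x\<close>, then \<open>seen x\<close> is the
  probability that it is positive and \<open>few j x\<close> the probability that it lies in \<open>{1..<j}\<close>.
\<close>

definition seen :: "real \<Rightarrow> real" where
  "seen x = 1 - exp (- x)"

definition few :: "nat \<Rightarrow> real \<Rightarrow> real" where
  "few j x = exp (- x) * (\<Sum>k=1..<j. x ^ k / fact k)"

text \<open>
  The derivative of \<open>few j\<close>; the sum of derivatives telescopes. Relative to the derivative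
  \<open>exp (- x)\<close> of \<open>seen\<close> it is the decreasing function \<open>1 - x ^ (j - 1) / fact (j - 1)\<close>.
\<close>

definition few' :: "nat \<Rightarrow> real \<Rightarrow> real" where
  "few' j x = exp (- x) * (1 - x ^ (j - 1) / fact (j - 1))"

lemma seen_deriv: "(seen has_field_derivative exp (- x)) (at x)"
  unfolding seen_def by (auto intro!: derivative_eq_intros)

lemma few_deriv:
  assumes "1 \<le> j"
  shows "(few j has_field_derivative few' j x) (at x)"
  using assms
proof (induction j rule: nat_induct_at_least)
  case base
  then show ?case by (simp add: few_def few'_def)
next
  case (Suc n)
  have eq: "few (Suc n) = (\<lambda>x. few n x + exp (- x) * (x ^ n / fact n))"
    using Suc.hyps by (auto simp: few_def fun_eq_iff algebra_simps)
  obtain k where n: "n = Suc k" using Suc.hyps by (cases n) auto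
  have "((\<lambda>x. few n x + exp (- x) * (x ^ n / fact n)) has_field_derivative
     few' n x + (- exp (- x) * (x ^ n / fact n) + exp (- x) * (real n * x ^ (n - 1) / fact n))) (at x)"
    by (rule DERIV_add[OF Suc.IH]) (auto intro!: derivative_eq_intros simp: field_simps)
  moreover have "few' n x + (- exp (- x) * (x ^ n / fact n) + exp (- x) * (real n * x ^ (n - 1) / fact n))
      = few' (Suc n) x"
  proof -
    have fact_shift: "real n * x ^ (n - 1) / fact n = x ^ (n - 1) / fact (n - 1)"
      by (simp add: n divide_simps)
    show ?thesis
      unfolding few'_def fact_shift by (simp add: ring_distribs)
  qed
  ultimately show ?case
    unfolding eq by simp
qed

lemma few_nonneg: "0 \<le> x \<Longrightarrow> 0 \<le> few j x"
  unfolding few_def by (intro mult_nonneg_nonneg sum_nonneg) auto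

lemma few_pos: "0 < x \<Longrightarrow> 2 \<le> j \<Longrightarrow> 0 < few j x"
  unfolding few_def by (intro mult_pos_pos sum_pos) auto

lemma continuous_on_seen [continuous_intros]: "continuous_on X f \<Longrightarrow> continuous_on X (\<lambda>x. seen (f x))"
  unfolding seen_def by (intro continuous_intros)

lemma continuous_on_few [continuous_intros]: "continuous_on X f \<Longrightarrow> continuous_on X (\<lambda>x. few j (f x))"
  unfolding few_def by (intro continuous_intros) auto

lemma continuous_on_few' [continuous_intros]: "continuous_on X f \<Longrightarrow> continuous_on X (\<lambda>x. few' j (f x))"
  unfolding few'_def by (intro continuous_intros) auto

text \<open>
  The quotient of the derivatives of \<open>few j\<close> and \<open>seen\<close> is strictly decreasing, written without
  division. The sign of the \<open>s\<close>-derivative below rests on this.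
\<close>

lemma few'_exp_antimono:
  assumes "0 \<le> x" "x < y" "2 \<le> j"
  shows "few' j y * exp (- x) < few' j x * exp (- y)"
proof -
  have "x ^ (j - 1) < y ^ (j - 1)"
    using assms by (intro power_strict_mono) auto
  then have "1 - y ^ (j - 1) / fact (j - 1) < 1 - x ^ (j - 1) / fact (j - 1)"
    by (simp add: divide_strict_right_mono)
  then have "exp (- x) * exp (- y) * (1 - y ^ (j - 1) / fact (j - 1))
      < exp (- x) * exp (- y) * (1 - x ^ (j - 1) / fact (j - 1))"
    by (intro mult_strict_left_mono) auto
  then show ?thesis by (simp add: few'_def algebra_simps)
qed

section \<open>Derivatives of products along a curve\<close>

text \<open>
  The derivative of \<open>\<Prod>i\<in>I. f (x i)\<close> when the point \<open>x\<close> moves with velocity \<open>v\<close>. Both partial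
  derivatives below have this form: with \<open>x i = (a i + s) * t\<close> the velocity is \<open>t\<close> for every \<open>i\<close>
  in the direction of \<open>s\<close>, and \<open>a i + s\<close> in the direction of \<open>t\<close>.
\<close>

definition dprod :: "(real \<Rightarrow> real) \<Rightarrow> (real \<Rightarrow> real) \<Rightarrow> 'a set \<Rightarrow> ('a \<Rightarrow> real) \<Rightarrow> ('a \<Rightarrow> real) \<Rightarrow> real" where
  "dprod f f' I v x = (\<Sum>i\<in>I. v i * f' (x i) * (\<Prod>l\<in>I - {i}. f (x l)))"

lemma has_field_derivative_prod_compose:
  assumes f: "\<And>x. (f has_field_derivative f' x) (at x)"
    and x: "\<And>i. i \<in> I \<Longrightarrow> (x i has_field_derivative v i) (at r)"
  shows "((\<lambda>r. \<Prod>i\<in>I. f (x i r)) has_field_derivative dprod f f' I v (\<lambda>i. x i r)) (at r)"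
proof -
  have "((\<lambda>r. f (x i r)) has_field_derivative v i * f' (x i r)) (at r)" if "i \<in> I" for i
    using DERIV_chain2[OF f x[OF that]] by (simp add: mult.commute)
  from has_field_derivative_prod[OF this] show ?thesis
    by (simp add: dprod_def)
qed

text \<open>
  The derivative of \<open>dprod f f' I v x\<close> when \<open>x\<close> moves with velocity \<open>w\<close> and \<open>v\<close> with velocity \<open>u\<close>.
\<close>

definition dprod2 :: "(real \<Rightarrow> real) \<Rightarrow> (real \<Rightarrow> real) \<Rightarrow> (real \<Rightarrow> real) \<Rightarrow> 'a set \<Rightarrow>
    ('a \<Rightarrow> real) \<Rightarrow> ('a \<Rightarrow> real) \<Rightarrow> ('a \<Rightarrow> real) \<Rightarrow> ('a \<Rightarrow> real) \<Rightarrow> real" where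
  "dprod2 f f' f'' I v w u x =
     (\<Sum>i\<in>I. (u i * f' (x i) + v i * w i * f'' (x i)) * (\<Prod>l\<in>I - {i}. f (x l)))
     + (\<Sum>i\<in>I. \<Sum>k\<in>I - {i}. v i * w k * f' (x i) * f' (x k) * (\<Prod>l\<in>I - {i} - {k}. f (x l)))"

text \<open>
  Equality of mixed partial derivatives: if \<open>v\<close> and \<open>w\<close> are the velocities in two directions, \<open>u\<close> is
  the common mixed second derivative of \<open>x\<close>, and exchanging the directions exchanges \<open>v\<close> and \<open>w\<close>.
\<close>

lemma dprod2_commute:
  assumes "finite I"
  shows "dprod2 f f' f'' I v w u x = dprod2 f f' f'' I w v u x"
proof -
  have "(\<Sum>i\<in>I. \<Sum>k\<in>I - {i}. v i * w k * f' (x i) * f' (x k) * (\<Prod>l\<in>I - {i} - {k}. f (x l)))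
      = (\<Sum>(i, k)\<in>Sigma I (\<lambda>i. I - {i}). v i * w k * f' (x i) * f' (x k) * (\<Prod>l\<in>I - {i} - {k}. f (x l)))"
    using assms by (simp add: sum.Sigma)
  also have "\<dots> = (\<Sum>(i, k)\<in>Sigma I (\<lambda>i. I - {i}). w i * v k * f' (x i) * f' (x k) * (\<Prod>l\<in>I - {i} - {k}. f (x l)))"
    by (rule sum.reindex_bij_witness[of _ prod.swap prod.swap])
       (auto simp: Diff_insert2[symmetric] Diff_insert[symmetric] insert_commute mult_ac)
  also have "\<dots> = (\<Sum>i\<in>I. \<Sum>k\<in>I - {i}. w i * v k * f' (x i) * f' (x k) * (\<Prod>l\<in>I - {i} - {k}. f (x l)))"
    using assms by (simp add: sum.Sigma)
  finally show ?thesis by (simp add: dprod2_def mult_ac)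
qed

lemma has_field_derivative_dprod:
  assumes f: "\<And>x. (f has_field_derivative f' x) (at x)"
    and f': "\<And>x. (f' has_field_derivative f'' x) (at x)"
    and v: "\<And>i. i \<in> I \<Longrightarrow> (v i has_field_derivative u i) (at r)"
    and x: "\<And>i. i \<in> I \<Longrightarrow> (x i has_field_derivative w i) (at r)"
  shows "((\<lambda>r. dprod f f' I (\<lambda>i. v i r) (\<lambda>i. x i r)) has_field_derivative
          dprod2 f f' f'' I (\<lambda>i. v i r) w u (\<lambda>i. x i r)) (at r)"
proof -
  have "((\<lambda>r. v i r * f' (x i r) * (\<Prod>l\<in>I - {i}. f (x l r))) has_field_derivative
     (u i * f' (x i r) + v i r * (w i * f'' (x i r))) * (\<Prod>l\<in>I - {i}. f (x l r))
       + v i r * f' (x i r) * dprod f f' (I - {i}) w (\<lambda>i. x i r)) (at r)" if i: "i \<in> I" for i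
  proof -
    have 1: "((\<lambda>r. f' (x i r)) has_field_derivative w i * f'' (x i r)) (at r)"
      using DERIV_chain2[OF f' x[OF i]] by (simp add: mult.commute)
    have 2: "((\<lambda>r. \<Prod>l\<in>I - {i}. f (x l r)) has_field_derivative dprod f f' (I - {i}) w (\<lambda>i. x i r)) (at r)"
      by (rule has_field_derivative_prod_compose[OF f x]) auto
    show ?thesis
      using DERIV_mult[OF DERIV_mult[OF v[OF i] 1] 2] by (simp add: algebra_simps)
  qed
  then have "((\<lambda>r. \<Sum>i\<in>I. v i r * f' (x i r) * (\<Prod>l\<in>I - {i}. f (x l r))) has_field_derivative
     (\<Sum>i\<in>I. (u i * f' (x i r) + v i r * (w i * f'' (x i r))) * (\<Prod>l\<in>I - {i}. f (x l r))
       + v i r * f' (x i r) * dprod f f' (I - {i}) w (\<lambda>i. x i r))) (at r)"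
    by (rule DERIV_sum)
  then show ?thesis
    unfolding dprod_def dprod2_def
    by (simp add: sum.distrib sum_distrib_left mult_ac)
qed


section \<open>A common increase of all rates\<close>

text \<open>
  The Jacobian of two products expands into \<open>2 \<times> 2\<close> minors of the velocities, because for each
  pair \<open>(i, k)\<close> the two terms share all remaining factors.
\<close>

lemma dprod_minor:
  fixes S :: "'n::finite set"
  shows "dprod f f' S v x * dprod g g' (- S) w x - dprod f f' S w x * dprod g g' (- S) v x
    = (\<Sum>i\<in>S. \<Sum>k\<in>- S. (v i * w k - w i * v k) * (f' (x i) * g' (x k))
        * ((\<Prod>l\<in>S - {i}. f (x l)) * (\<Prod>l\<in>- S - {k}. g (x l))))"
  unfolding dprod_def sum_product sum_subtractf[symmetric]
  by (intro sum.cong refl) (simp add: algebra_simps)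

text \<open>
  With \<open>v i = t\<close> and \<open>w i = a i + s\<close> the minor belonging to \<open>(i, k)\<close> is \<open>t * (a k - a i)\<close>, which has no
  fixed sign. Exchanging the roles of \<open>i\<in>S\<close> and \<open>k\<notin>S\<close>, that is, passing to the set
  \<open>insert k (S - {i})\<close> of the same size, keeps all other factors, so the sum may be taken over such pairs
  of terms. Each pair contributes \<open>a k - a i\<close> times a difference of the same sign, by
  \<open>few'_exp_antimono\<close>. Sets of size \<open>m\<close> that separate the two types with different rates exist
  because \<open>1 \<le> m < CARD('n)\<close>; they make the sum strictly positive.
\<close>

lemma sum_minors_pos:
  fixes a :: "'n::finite \<Rightarrow> real"
  assumes m: "1 \<le> m" "m < CARD('n)" and j: "2 \<le> j"
    and pos: "\<And>i. 0 < a i + s" and ne: "a p \<noteq> a q" and t: "0 < t"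
  defines "x \<equiv> \<lambda>i. (a i + s) * t"
  shows "0 < (\<Sum>S | card S = m.
       dprod (few j) (few' j) S (\<lambda>_. t) x * dprod seen (\<lambda>x. exp (- x)) (- S) (\<lambda>i. a i + s) x
     - dprod (few j) (few' j) S (\<lambda>i. a i + s) x * dprod seen (\<lambda>x. exp (- x)) (- S) (\<lambda>_. t) x)"
    (is "0 < ?Q")
proof -
  define R where "R = (\<lambda>S i k. (\<Prod>l\<in>S - {i}. few j (x l)) * (\<Prod>l\<in>- S - {k}. seen (x l)))"
  define \<phi> where "\<phi> = (\<lambda>(S, i, k). t * (a k - a i) * (few' j (x i) * exp (- x k)) * R S i k)"
  define \<sigma> where "\<sigma> = (\<lambda>(S, i :: 'n, k :: 'n). (insert k (S - {i}), k, i))"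
  define Z where "Z = Sigma {S :: 'n set. card S = m} (\<lambda>S. S \<times> (- S))"
  have xpos: "0 < x i" for i
    using pos[of i] t by (simp add: x_def)
  have Rpos: "0 < R S i k" for S i k
    unfolding R_def using xpos j by (intro mult_pos_pos prod_pos) (auto intro: few_pos simp: seen_def)
  have Q: "?Q = (\<Sum>z\<in>Z. \<phi> z)"
    unfolding dprod_minor Z_def
    by (simp add: sum.Sigma[symmetric] sum.cartesian_product[symmetric] \<phi>_def R_def algebra_simps)
  have "(\<Sum>z\<in>Z. \<phi> z) = (\<Sum>z\<in>Z. \<phi> (\<sigma> z))"
    by (rule sum.reindex_bij_witness[of _ \<sigma> \<sigma>])
       (auto simp: Z_def \<sigma>_def insert_absorb card_gt_0_iff intro!: Suc_pred)
  \<comment> \<open>Summing once over the index and once over its exchanged partner counts everything twice.\<close>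
  then have "2 * ?Q = (\<Sum>z\<in>Z. \<phi> z + \<phi> (\<sigma> z))"
    by (simp add: Q sum.distrib)
  also have "\<dots> > 0"
  proof -
    have eq: "\<phi> (S, i, k) + \<phi> (\<sigma> (S, i, k))
        = t * R S i k * ((a k - a i) * (few' j (x i) * exp (- x k) - few' j (x k) * exp (- x i)))"
      if "(S, i, k) \<in> Z" for S i k
    proof -
      have "insert k (S - {i}) - {k} = S - {i}" "- insert k (S - {i}) - {i} = - S - {k}"
        using that by (auto simp: Z_def)
      then have "R (insert k (S - {i})) k i = R S i k"
        unfolding R_def by (simp only:)
      then show ?thesis
        by (simp add: \<phi>_def \<sigma>_def algebra_simps)
    qed
    have sgn: "0 < (a k - a i) * (few' j (x i) * exp (- x k) - few' j (x k) * exp (- x i))"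
      if "a i \<noteq> a k" for i k
    proof (cases "a i < a k")
      case True
      then have "x i < x k" using t by (simp add: x_def)
      from few'_exp_antimono[OF _ this j] show ?thesis
        using True xpos[of i] by (intro mult_pos_pos) auto
    next
      case False
      then have "a k < a i" using that by simp
      then have "x k < x i" using t by (simp add: x_def)
      from few'_exp_antimono[OF _ this j] show ?thesis
        using \<open>a k < a i\<close> xpos[of k] by (intro mult_neg_neg) auto
    qed
    have pq: "p \<noteq> q" using ne by auto
    then have "m - 1 \<le> card (- {p, q})"
      using m by (simp add: Compl_eq_Diff_UNIV card_Diff_subset card_insert_if)
    then obtain S0 where S0: "S0 \<subseteq> - {p, q}" "card S0 = m - 1"
      by (meson obtain_subset_with_card_n)
    have fin: "finite Z" by simp
    have mem: "(insert p S0, p, q) \<in> Z"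
      using S0 m ne by (auto simp: Z_def card_insert_if)
    show ?thesis
    proof (rule sum_pos2[OF fin mem])
      show "0 < \<phi> (insert p S0, p, q) + \<phi> (\<sigma> (insert p S0, p, q))"
        unfolding eq[OF mem] by (intro mult_pos_pos t Rpos sgn ne)
      show "0 \<le> \<phi> z + \<phi> (\<sigma> z)" if z: "z \<in> Z" for z
      proof -
        obtain S i k where zz: "z = (S, i, k)" by (cases z) auto
        have "0 \<le> (a k - a i) * (few' j (x i) * exp (- x k) - few' j (x k) * exp (- x i))"
          using sgn[of i k] by (cases "a i = a k") auto
        then show ?thesis
          unfolding zz eq[OF z[unfolded zz]] using t Rpos[of S i k] by simp
      qed
    qed
  qed
  finally show ?thesis by simp
qed

text \<open>
  If coupons of type \<open>i\<close> arrive as a Poisson process of rate \<open>r i\<close>, independently for distinct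
  types, this is the sum, over the sets \<open>S\<close> of \<open>m\<close> types, of the density at time \<open>t\<close> of the event
  that the collection is completed at \<open>t\<close> by a type outside \<open>S\<close> while all types in \<open>S\<close> have
  positive counts less than \<open>j\<close>. The second factor is the \<open>t\<close>-derivative of
  \<open>\<Prod>k\<in>-S. seen (r k * t)\<close>; its summands choose the last type.
\<close>

definition collector_integrand :: "nat \<Rightarrow> nat \<Rightarrow> ('n::finite \<Rightarrow> real) \<Rightarrow> real \<Rightarrow> real" where
  "collector_integrand m j r t = (\<Sum>S | card S = m. (\<Prod>i\<in>S. few j (r i * t)) *
      dprod seen (\<lambda>x. exp (- x)) (- S) r (\<lambda>i. r i * t))"

lemma continuous_on_dprod [continuous_intros]:
  assumes "\<And>h. continuous_on X h \<Longrightarrow> continuous_on X (\<lambda>z. f (h z))"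
    and "\<And>h. continuous_on X h \<Longrightarrow> continuous_on X (\<lambda>z. f' (h z))"
    and "\<And>i. continuous_on X (\<lambda>z. v z i)" "\<And>i. continuous_on X (\<lambda>z. x z i)"
  shows "continuous_on X (\<lambda>z. dprod f f' I (v z) (x z))"
  unfolding dprod_def by (intro continuous_intros assms)

text \<open>
  By \<open>deriv_integral_product\<close>, the \<open>s\<close>-derivative of the integral over \<open>{0..T}\<close> is a boundary term
  at \<open>T\<close>, which is nonnegative, plus the integral of the positive sum of \<open>sum_minors_pos\<close>. The
  gain \<open>\<epsilon>\<close> does not depend on \<open>T\<close>, so it survives the limit \<open>T \<rightarrow> \<infinity>\<close>: the integral of the sum
  over \<open>{1..2}\<close> alone is bounded below, by compactness of \<open>{s1..s2} \<times> {1..2}\<close>. The interval \<open>{1..2}\<close>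
  stays away from \<open>t = 0\<close>, where the sum vanishes.
\<close>

lemma integral_strict_increase:
  fixes a :: "'n::finite \<Rightarrow> real"
  assumes m: "1 \<le> m" "m < CARD('n)" and j: "2 \<le> j"
    and a: "\<And>i. 0 < a i" and ne: "a p \<noteq> a q" and s: "0 \<le> s1" "s1 < s2"
  shows "\<exists>\<epsilon>>0. \<forall>T\<ge>2. integral {0..T} (collector_integrand m j (\<lambda>i. a i + s1)) + \<epsilon>
            \<le> integral {0..T} (collector_integrand m j (\<lambda>i. a i + s2))"
proof -
  let ?f = "few j" and ?f' = "few' j" and ?g' = "\<lambda>x :: real. exp (- x)"
  define A where "A = (\<lambda>S s t. \<Prod>i\<in>S. ?f ((a i + s) * t))"
  define As where "As = (\<lambda>S s t. dprod ?f ?f' S (\<lambda>_. t) (\<lambda>i. (a i + s) * t))"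
  define At where "At = (\<lambda>S s t. dprod ?f ?f' S (\<lambda>i. a i + s) (\<lambda>i. (a i + s) * t))"
  define Bs where "Bs = (\<lambda>S s t. dprod seen ?g' (- S) (\<lambda>_. t) (\<lambda>i. (a i + s) * t))"
  define Bt where "Bt = (\<lambda>S s t. dprod seen ?g' (- S) (\<lambda>i. a i + s) (\<lambda>i. (a i + s) * t))"
  define Bst where "Bst = (\<lambda>S s t. dprod2 seen ?g' (\<lambda>x. - ?g' x) (- S) (\<lambda>i. a i + s) (\<lambda>_. t) (\<lambda>_. 1)
     (\<lambda>i. (a i + s) * t))"
  define Q where "Q = (\<lambda>s t. \<Sum>S | card S = m. As S s t * Bt S s t - At S s t * Bs S s t)"
  define J where "J = (\<lambda>T s. integral {0..T} (collector_integrand m j (\<lambda>i. a i + s)))"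
  note defs = A_def As_def At_def Bs_def Bt_def Bst_def
  have g': "(?g' has_field_derivative - ?g' x) (at x)" for x
    by (auto intro!: derivative_eq_intros)
  have f': "(?f has_field_derivative ?f' x) (at x)" for x
    using few_deriv j by simp
  have cont: "continuous_on UNIV (\<lambda>x. A S (fst x) (snd x))" "continuous_on UNIV (\<lambda>x. As S (fst x) (snd x))"
      "continuous_on UNIV (\<lambda>x. At S (fst x) (snd x))" "continuous_on UNIV (\<lambda>x. Bs S (fst x) (snd x))"
      "continuous_on UNIV (\<lambda>x. Bt S (fst x) (snd x))" "continuous_on UNIV (\<lambda>x. Bst S (fst x) (snd x))" for S
    unfolding defs dprod2_def by (intro continuous_intros; assumption)+
  have derA: "((\<lambda>s. A S s t) has_field_derivative As S s t) (at s)"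
     "(A S s has_field_derivative At S s t) (at t)" for S s t
    unfolding defs by (rule has_field_derivative_prod_compose[OF f']; auto intro!: derivative_eq_intros)+
  have derB: "((\<lambda>s. Bt S s t) has_field_derivative Bst S s t) (at s)" for S s t
    unfolding defs by (rule has_field_derivative_dprod[OF seen_deriv g']; auto intro!: derivative_eq_intros)
  have derB': "(Bs S s has_field_derivative Bst S s t) (at t)" for S s t
    unfolding defs by (subst dprod2_commute, simp)
      (rule has_field_derivative_dprod[OF seen_deriv g']; auto intro!: derivative_eq_intros)
  have J: "J T s = (\<Sum>S | card S = m. integral {0..T} (\<lambda>t. A S s t * Bt S s t))" for T s
    unfolding J_def collector_integrand_def
    by (subst integral_sum[symmetric])
       (auto simp: A_def Bt_def intro!: integrable_continuous_interval continuous_intros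
          continuous_on_slice[OF cont(1), unfolded A_def] continuous_on_slice[OF cont(5), unfolded Bt_def])
  have Qint: "(Q s) integrable_on {u..v}" for s u v
    unfolding Q_def by (intro integrable_continuous_interval continuous_intros continuous_on_slice[OF cont(2)]
       continuous_on_slice[OF cont(3)] continuous_on_slice[OF cont(4)] continuous_on_slice[OF cont(5)])
  have Qpos: "0 < Q s t" if "0 \<le> s" "0 < t" for s t
    unfolding Q_def defs
    by (rule sum_minors_pos[OF m j _ ne that(2)]) (use a that in \<open>auto intro: add_pos_nonneg\<close>)
  have derJ: "(J T has_field_derivative (\<Sum>S | card S = m. A S s T * Bs S s T) + integral {0..T} (Q s)) (at s)"
    if T: "0 \<le> T" for T s
  proof -
    have Bs0: "Bs S s 0 = 0" for S s
      by (simp add: Bs_def dprod_def)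
    have "((\<lambda>s. integral {0..T} (\<lambda>t. A S s t * Bt S s t)) has_field_derivative
           A S s T * Bs S s T - A S s 0 * Bs S s 0
             + integral {0..T} (\<lambda>t. As S s t * Bt S s t - At S s t * Bs S s t)) (at s)" for S
      by (rule deriv_integral_product[OF derA derB derB' cont T])
    then have "(J T has_field_derivative (\<Sum>S | card S = m. A S s T * Bs S s T - A S s 0 * Bs S s 0
             + integral {0..T} (\<lambda>t. As S s t * Bt S s t - At S s t * Bs S s t))) (at s)"
      unfolding J by (rule DERIV_sum)
    also have "(\<Sum>S | card S = m. A S s T * Bs S s T - A S s 0 * Bs S s 0
             + integral {0..T} (\<lambda>t. As S s t * Bt S s t - At S s t * Bs S s t))
        = (\<Sum>S | card S = m. A S s T * Bs S s T) + integral {0..T} (Q s)"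
      unfolding Q_def Bs0 sum.distrib
      by (subst integral_sum)
         (auto intro!: integrable_continuous_interval continuous_intros continuous_on_slice[OF cont(2)]
       continuous_on_slice[OF cont(3)] continuous_on_slice[OF cont(4)] continuous_on_slice[OF cont(5)])
    finally show ?thesis .
  qed
  have bdry: "0 \<le> A S s T * Bs S s T" if "0 \<le> s" "0 \<le> T" for S s T
  proof -
    have "0 \<le> (a i + s) * T" for i
      using a[of i] that by simp
    then show ?thesis
      unfolding A_def Bs_def dprod_def using that
      by (intro mult_nonneg_nonneg prod_nonneg sum_nonneg) (auto simp: few_nonneg seen_def)
  qed
  obtain z where z: "z \<in> {s1..s2} \<times> {1..2}" "\<And>y. y \<in> {s1..s2} \<times> {1..2} \<Longrightarrow> Q (fst z) (snd z) \<le> Q (fst y) (snd y)"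
  proof (rule bexE[OF continuous_attains_inf[of "{s1..s2} \<times> {1..2::real}" "\<lambda>x. Q (fst x) (snd x)"]])
    show "compact ({s1..s2} \<times> {1..2::real})" by (intro compact_Times) auto
    show "{s1..s2} \<times> {1..2::real} \<noteq> {}" using s by auto
    show "continuous_on ({s1..s2} \<times> {1..2}) (\<lambda>x. Q (fst x) (snd x))"
      unfolding Q_def
      by (rule continuous_on_subset[OF _ subset_UNIV]) (intro continuous_intros cont)
  qed auto
  define \<mu> where "\<mu> = Q (fst z) (snd z)"
  have \<mu>: "0 < \<mu>" "\<And>s t. s \<in> {s1..s2} \<Longrightarrow> t \<in> {1..2} \<Longrightarrow> \<mu> \<le> Q s t"
    using z s by (auto simp: \<mu>_def intro!: Qpos)
  have "J T s1 + (s2 - s1) * \<mu> \<le> J T s2" if T: "2 \<le> T" for T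
  proof -
    obtain \<xi> where \<xi>: "s1 < \<xi>" "\<xi> < s2"
      "J T s2 - J T s1 = (s2 - s1) * ((\<Sum>S | card S = m. A S \<xi> T * Bs S \<xi> T) + integral {0..T} (Q \<xi>))"
      using MVT2[OF s(2), of "J T"] derJ[of T] T by fastforce
    have Q0: "0 \<le> Q \<xi> t" if "0 \<le> t" for t
    proof (cases "t = 0")
      case True
      then show ?thesis by (simp add: Q_def As_def Bs_def dprod_def)
    next
      case False
      then show ?thesis using Qpos[of \<xi> t] that \<xi> s by simp
    qed
    have "\<mu> = integral {1..2::real} (\<lambda>_. \<mu>)" by simp
    also have "\<dots> \<le> integral {1..2} (Q \<xi>)"
      using \<mu>(2)[of \<xi>] \<xi> by (intro integral_le Qint) auto
    also have "\<dots> \<le> integral {0..T} (Q \<xi>)"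
      using T Q0 by (intro integral_subset_le Qint) auto
    also have "\<dots> \<le> (\<Sum>S | card S = m. A S \<xi> T * Bs S \<xi> T) + integral {0..T} (Q \<xi>)"
      using bdry[of \<xi> T] \<xi> s T by (simp add: sum_nonneg)
    finally have "(s2 - s1) * \<mu> \<le> J T s2 - J T s1"
      unfolding \<xi>(3) using s by (intro mult_left_mono) auto
    then show ?thesis by simp
  qed
  then show ?thesis
    using s \<mu>(1) unfolding J_def by (intro exI[of _ "(s2 - s1) * \<mu>"]) auto
qed

section \<open>Words with prescribed letter counts\<close>

definition words :: "('a \<Rightarrow> nat set) \<Rightarrow> 'a set \<Rightarrow> nat set \<Rightarrow> (nat \<Rightarrow> 'a) set" where
  "words K A P = {w \<in> P \<rightarrow>\<^sub>E A. \<forall>i\<in>A. card {s\<in>P. w s = i} \<in> K i}"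

text \<open>
  The exponential generating function of the runs of one letter of weight \<open>q\<close> whose length is
  restricted to \<open>K\<close>.
\<close>

definition egf :: "nat set \<Rightarrow> real \<Rightarrow> real fps" where
  "egf K q = Abs_fps (\<lambda>k. if k \<in> K then q ^ k / fact k else 0)"

lemma finite_words: "finite A \<Longrightarrow> finite P \<Longrightarrow> finite (words K A P)"
  unfolding words_def by (rule finite_subset[OF _ finite_PiE[of P "\<lambda>_. A"]]) auto

text \<open>
  A word over \<open>insert a A\<close> is determined by the set \<open>Q\<close> of positions of \<open>a\<close> and a word over \<open>A\<close> on
  the other positions. Since these are an arbitrary set, words are indexed by sets of positions
  rather than by their length.
\<close>

lemma sum_words_insert:
  fixes q :: "'a \<Rightarrow> real"
  assumes a: "a \<notin> A" and P: "finite P" and A: "finite A"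
  shows "(\<Sum>w\<in>words K (insert a A) P. \<Prod>s\<in>P. q (w s))
    = (\<Sum>Q | Q \<subseteq> P \<and> card Q \<in> K a. q a ^ card Q * (\<Sum>w\<in>words K A (P - Q). \<Prod>s\<in>P - Q. q (w s)))"
proof -
  define I where "I = Sigma {Q. Q \<subseteq> P \<and> card Q \<in> K a} (\<lambda>Q. words K A (P - Q))"
  have "(\<Sum>Q | Q \<subseteq> P \<and> card Q \<in> K a. q a ^ card Q * (\<Sum>w\<in>words K A (P - Q). \<Prod>s\<in>P - Q. q (w s)))
     = (\<Sum>(Q, w)\<in>I. q a ^ card Q * (\<Prod>s\<in>P - Q. q (w s)))"
    unfolding I_def sum_distrib_left using P A
    by (subst sum.Sigma) (auto simp: finite_words)
  also have "\<dots> = (\<Sum>w\<in>words K (insert a A) P. \<Prod>s\<in>P. q (w s))"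
  proof (rule sum.reindex_bij_witness[symmetric,
      of _ "\<lambda>(Q, w) s. if s \<in> Q then a else w s" "\<lambda>w. ({s\<in>P. w s = a}, restrict w {s\<in>P. w s \<noteq> a})"])
    fix w assume w: "w \<in> words K (insert a A) P"
    then have wA: "w s \<in> A" if "s \<in> P" "w s \<noteq> a" for s
      using that by (auto simp: words_def PiE_iff)
    have PQ: "P - {s\<in>P. w s = a} = {s\<in>P. w s \<noteq> a}" by auto
    show "(case ({s\<in>P. w s = a}, restrict w {s\<in>P. w s \<noteq> a}) of (Q, w) \<Rightarrow> \<lambda>s. if s \<in> Q then a else w s) = w"
      using w by (auto simp: words_def PiE_iff extensional_def fun_eq_iff)
    have "restrict w {s\<in>P. w s \<noteq> a} \<in> words K A {s\<in>P. w s \<noteq> a}"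
      unfolding words_def
    proof (intro CollectI conjI ballI)
      show "restrict w {s\<in>P. w s \<noteq> a} \<in> {s\<in>P. w s \<noteq> a} \<rightarrow>\<^sub>E A"
        using wA by auto
      fix i assume i: "i \<in> A"
      then have "{s\<in>{s\<in>P. w s \<noteq> a}. restrict w {s\<in>P. w s \<noteq> a} s = i} = {s\<in>P. w s = i}"
        using a by auto
      then show "card {s\<in>{s\<in>P. w s \<noteq> a}. restrict w {s\<in>P. w s \<noteq> a} s = i} \<in> K i"
        using w i by (simp only: words_def) simp
    qed
    then show "({s\<in>P. w s = a}, restrict w {s\<in>P. w s \<noteq> a}) \<in> I"
      using w unfolding I_def PQ[symmetric] by (auto simp: words_def)
    have "(\<Prod>s\<in>P. q (w s)) = (\<Prod>s\<in>{s\<in>P. w s = a}. q (w s)) * (\<Prod>s\<in>P - {s\<in>P. w s = a}. q (w s))"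
      using P by (subst prod.subset_diff[of "{s\<in>P. w s = a}"]) (auto simp: mult.commute)
    also have "\<dots> = q a ^ card {s\<in>P. w s = a} * (\<Prod>s\<in>P - {s\<in>P. w s = a}. q (restrict w {s\<in>P. w s \<noteq> a} s))"
      unfolding PQ by (intro arg_cong2[where f = "(*)"] prod.cong) simp_all
    finally show "(case ({s\<in>P. w s = a}, restrict w {s\<in>P. w s \<noteq> a}) of
        (Q, w) \<Rightarrow> q a ^ card Q * (\<Prod>s\<in>P - Q. q (w s))) = (\<Prod>s\<in>P. q (w s))"
      by simp
  next
    fix z assume "z \<in> I"
    then obtain Q w where z: "z = (Q, w)" and Q: "Q \<subseteq> P" "card Q \<in> K a" and w: "w \<in> words K A (P - Q)"
      by (auto simp: I_def)
    let ?v = "\<lambda>s. if s \<in> Q then a else w s"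
    have wA: "w s \<in> A" if "s \<in> P" "s \<notin> Q" for s
      using w that by (auto simp: words_def PiE_iff)
    then have wa: "w s \<noteq> a" if "s \<in> P" "s \<notin> Q" for s
      using that a by blast
    have Qeq: "{s\<in>P. ?v s = a} = Q" and Qc: "{s\<in>P. ?v s \<noteq> a} = P - Q"
      using Q(1) wa by auto
    show "((\<lambda>w. ({s\<in>P. w s = a}, restrict w {s\<in>P. w s \<noteq> a})) ((\<lambda>(Q, w) s. if s \<in> Q then a else w s) z)) = z"
      unfolding z prod.case Qeq Qc using w
      by (auto simp: fun_eq_iff words_def PiE_iff extensional_def)
    have "card {s\<in>P. ?v s = i} = card {s\<in>P - Q. w s = i}" if "i \<in> A" for i
      using that a by (intro arg_cong[where f = card]) auto
    then have "card {s\<in>P. ?v s = i} \<in> K i" if "i \<in> A" for i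
      using w that by (auto simp: words_def)
    moreover have "?v \<in> P \<rightarrow>\<^sub>E insert a A"
      using w Q wA by (auto simp: words_def PiE_iff extensional_def)
    ultimately show "(case z of (Q, w) \<Rightarrow> \<lambda>s. if s \<in> Q then a else w s) \<in> words K (insert a A) P"
      using Q Qeq unfolding words_def z by auto
  qed
  finally show ?thesis by simp
qed

text \<open>
  The product formula for exponential generating functions: the binomial coefficient that counts the
  positions of a letter is absorbed by the factorials.
\<close>

lemma sum_words_eq_egf:
  fixes q :: "'a \<Rightarrow> real"
  assumes A: "finite A" and P: "finite P"
  shows "(\<Sum>w\<in>words K A P. \<Prod>s\<in>P. q (w s)) = fact (card P) * fps_nth (\<Prod>i\<in>A. egf (K i) (q i)) (card P)"
  using A P
proof (induction A arbitrary: P rule: finite_induct)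
  case empty
  then show ?case
    by (cases "P = {}") (auto simp: words_def PiE_eq_empty_iff card_eq_0_iff)
next
  case (insert a A)
  let ?c = "fps_nth (\<Prod>i\<in>A. egf (K i) (q i))"
  let ?n = "card P"
  have "(\<Sum>w\<in>words K (insert a A) P. \<Prod>s\<in>P. q (w s))
    = (\<Sum>Q | Q \<subseteq> P \<and> card Q \<in> K a. q a ^ card Q * (fact (?n - card Q) * ?c (?n - card Q)))"
    unfolding sum_words_insert[OF insert.hyps(2) insert.prems insert.hyps(1)]
  proof (intro sum.cong refl)
    fix Q assume "Q \<in> {Q. Q \<subseteq> P \<and> card Q \<in> K a}"
    then have "card (P - Q) = ?n - card Q"
      using insert.prems by (auto intro: card_Diff_subset finite_subset)
    then show "q a ^ card Q * (\<Sum>w\<in>words K A (P - Q). \<Prod>s\<in>P - Q. q (w s))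
        = q a ^ card Q * (fact (?n - card Q) * ?c (?n - card Q))"
      using insert.IH[of "P - Q"] insert.prems by simp
  qed
  also have "\<dots> = (\<Sum>k\<in>{k. k \<le> ?n \<and> k \<in> K a}. \<Sum>Q | Q \<in> {Q. Q \<subseteq> P \<and> card Q \<in> K a} \<and> card Q = k.
       q a ^ card Q * (fact (?n - card Q) * ?c (?n - card Q)))"
    using insert.prems by (intro sum.group[symmetric]) (auto intro: card_mono)
  also have "\<dots> = (\<Sum>k\<in>{k. k \<le> ?n \<and> k \<in> K a}. fact ?n * ((q a ^ k / fact k) * ?c (?n - k)))"
  proof (intro sum.cong refl)
    fix k assume k: "k \<in> {k. k \<le> ?n \<and> k \<in> K a}"
    then have "{Q. Q \<in> {Q. Q \<subseteq> P \<and> card Q \<in> K a} \<and> card Q = k} = {Q. Q \<subseteq> P \<and> card Q = k}"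
      by auto
    then have "(\<Sum>Q | Q \<in> {Q. Q \<subseteq> P \<and> card Q \<in> K a} \<and> card Q = k.
        q a ^ card Q * (fact (?n - card Q) * ?c (?n - card Q)))
      = real (?n choose k) * (q a ^ k * (fact (?n - k) * ?c (?n - k)))"
      using n_subsets[OF insert.prems, of k] by simp
    also have "\<dots> = fact ?n * ((q a ^ k / fact k) * ?c (?n - k))"
      using k by (simp add: binomial_fact)
    finally show "(\<Sum>Q | Q \<in> {Q. Q \<subseteq> P \<and> card Q \<in> K a} \<and> card Q = k.
        q a ^ card Q * (fact (?n - card Q) * ?c (?n - card Q))) = \<dots>" .
  qed
  also have "\<dots> = fact ?n * (\<Sum>k\<in>{k. k \<le> ?n \<and> k \<in> K a}. (q a ^ k / fact k) * ?c (?n - k))"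
    by (simp add: sum_distrib_left)
  also have "(\<Sum>k\<in>{k. k \<le> ?n \<and> k \<in> K a}. (q a ^ k / fact k) * ?c (?n - k))
     = fps_nth (egf (K a) (q a) * (\<Prod>i\<in>A. egf (K i) (q i))) ?n"
    unfolding fps_mult_nth egf_def
    by (intro sum.mono_neutral_cong_left) auto
  finally show ?case
    using insert.hyps by simp
qed

lemma sums_fps_prod_nonneg:
  fixes f :: "'a \<Rightarrow> real fps" and x :: real
  assumes A: "finite A" and f: "\<And>i. i \<in> A \<Longrightarrow> (\<lambda>n. fps_nth (f i) n * x ^ n) sums e i"
    and nn: "\<And>i n. i \<in> A \<Longrightarrow> 0 \<le> fps_nth (f i) n" and x: "0 \<le> x"
  shows "(\<lambda>n. fps_nth (\<Prod>i\<in>A. f i) n * x ^ n) sums (\<Prod>i\<in>A. e i) \<and> (\<forall>n. 0 \<le> fps_nth (\<Prod>i\<in>A. f i) n)"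
  using A f nn
proof (induction A rule: finite_induct)
  case empty
  have "(\<lambda>n. fps_nth 1 n * x ^ n) sums (1 :: real)"
    using sums_If_finite_set[of "{0}" "\<lambda>_. 1 :: real"] by (auto elim!: back_subst[of "\<lambda>f. f sums 1"])
  then show ?case by simp
next
  case (insert a A)
  define h where "h = (\<Prod>i\<in>A. f i)"
  have h: "(\<lambda>n. fps_nth h n * x ^ n) sums (\<Prod>i\<in>A. e i)" "\<And>n. 0 \<le> fps_nth h n"
    using insert unfolding h_def by auto
  have a: "(\<lambda>n. fps_nth (f a) n * x ^ n) sums e a" "\<And>n. 0 \<le> fps_nth (f a) n"
    using insert by auto
  have "(\<lambda>k. \<Sum>i\<le>k. (fps_nth (f a) i * x ^ i) * (fps_nth h (k - i) * x ^ (k - i))) sums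
      ((\<Sum>k. fps_nth (f a) k * x ^ k) * (\<Sum>k. fps_nth h k * x ^ k))"
    using a h x by (intro Cauchy_product_sums) (auto simp: sums_iff)
  also have "(\<lambda>k. \<Sum>i\<le>k. (fps_nth (f a) i * x ^ i) * (fps_nth h (k - i) * x ^ (k - i)))
      = (\<lambda>k. fps_nth (f a * h) k * x ^ k)"
  proof
    fix k
    have "x ^ i * x ^ (k - i) = x ^ k" if "i \<le> k" for i
      using that by (simp add: power_add[symmetric])
    then show "(\<Sum>i\<le>k. (fps_nth (f a) i * x ^ i) * (fps_nth h (k - i) * x ^ (k - i)))
      = fps_nth (f a * h) k * x ^ k"
      unfolding fps_mult_nth sum_distrib_right atLeast0AtMost
      by (intro sum.cong refl) (simp add: mult_ac)
  qed
  finally have "(\<lambda>k. fps_nth (f a * h) k * x ^ k) sums (e a * (\<Prod>i\<in>A. e i))"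
    using a h by (simp add: sums_iff)
  moreover have "0 \<le> fps_nth (f a * h) n" for n
    unfolding fps_mult_nth using a h by (intro sum_nonneg mult_nonneg_nonneg) auto
  ultimately show ?case
    using insert.hyps by (simp add: h_def)
qed

text \<open>
  The three restrictions on a count that occur: absent, between \<open>1\<close> and \<open>j - 1\<close>, and present.
\<close>

lemma egf_sums:
  shows "(\<lambda>n. fps_nth (egf {0} q) n * x ^ n) sums 1"
    and "(\<lambda>n. fps_nth (egf {1..<j} q) n * x ^ n) sums (\<Sum>k=1..<j. (q * x) ^ k / fact k)"
    and "(\<lambda>n. fps_nth (egf {1..} q) n * x ^ n) sums (exp (q * x) - 1)"
proof -
  show "(\<lambda>n. fps_nth (egf {0} q) n * x ^ n) sums 1"
    using sums_If_finite_set[of "{0}" "\<lambda>k. q ^ k / fact k * x ^ k"]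
    by (auto simp: egf_def if_distrib if_distribR cong: if_cong)
  show "(\<lambda>n. fps_nth (egf {1..<j} q) n * x ^ n) sums (\<Sum>k=1..<j. (q * x) ^ k / fact k)"
    using sums_If_finite_set[of "{1..<j}" "\<lambda>k. (q * x) ^ k / fact k"]
    by (simp add: egf_def if_distrib if_distribR power_mult_distrib cong: if_cong)
  have "(\<lambda>n. (q * x) ^ n / fact n) sums exp (q * x)"
    using exp_converges[of "q * x"] by (simp add: divide_inverse mult.commute scaleR_conv_of_real)
  moreover have "(\<lambda>n. if n \<in> {0} then 1 else 0) sums (\<Sum>n\<in>{0::nat}. 1 :: real)"
    by (rule sums_If_finite_set) simp
  ultimately have "(\<lambda>n. (q * x) ^ n / fact n - (if n \<in> {0} then 1 else 0)) sums (exp (q * x) - 1)"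
    using sums_diff by fastforce
  also have "(\<lambda>n. (q * x) ^ n / fact n - (if n \<in> {0} then 1 else 0)) = (\<lambda>n. fps_nth (egf {1..} q) n * x ^ n)"
    by (auto simp: egf_def power_mult_distrib fun_eq_iff not_le)
  finally show "(\<lambda>n. fps_nth (egf {1..} q) n * x ^ n) sums (exp (q * x) - 1)" .
qed

section \<open>Events determined by finitely many coupons\<close>

lemma space_coupon_space [simp]: "space (coupon_space p) = UNIV"
  by (simp add: coupon_space_def space_PiM PiE_def extensional_def)

lemma product_prob_space_coupon: "product_prob_space (\<lambda>_. measure_pmf (coupon_pmf p))"
  by (intro product_prob_spaceI) (rule measure_pmf.prob_space_axioms)

lemma prob_space_coupon_space: "prob_space (coupon_space p)"
  unfolding coupon_space_def by (intro prob_space_PiM) (rule measure_pmf.prob_space_axioms)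

lemma
  fixes p :: "real ^ 'n"
  shows sets_prefix_box: "{\<omega>. \<forall>s<n. \<omega> s \<in> B s} \<in> sets (coupon_space p)"
    and emeasure_prefix_box: "emeasure (coupon_space p) {\<omega>. \<forall>s<n. \<omega> s \<in> B s}
           = (\<Prod>s<n. emeasure (measure_pmf (coupon_pmf p)) (B s))"
proof -
  interpret product_prob_space "\<lambda>_. measure_pmf (coupon_pmf p)" UNIV
    by (rule product_prob_space_coupon)
  have eq: "{\<omega>. \<forall>s<n. \<omega> s \<in> B s} = prod_emb UNIV (\<lambda>_. measure_pmf (coupon_pmf p)) {..<n} (Pi\<^sub>E {..<n} B)"
    unfolding prod_emb_def space_PiM vimage_def restrict_PiE_iff by (simp add: Ball_def)
  show "{\<omega>. \<forall>s<n. \<omega> s \<in> B s} \<in> sets (coupon_space p)"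
    unfolding eq coupon_space_def by (intro sets_PiM_I) auto
  show "emeasure (coupon_space p) {\<omega>. \<forall>s<n. \<omega> s \<in> B s}
           = (\<Prod>s<n. emeasure (measure_pmf (coupon_pmf p)) (B s))"
    unfolding eq coupon_space_def by (rule emeasure_PiM_emb) auto
qed

lemma emeasure_prefix:
  fixes p :: "real ^ 'n"
  assumes "prob_vec p"
  shows "emeasure (coupon_space p) {\<omega>. \<forall>s<n. \<omega> s = w s} = ennreal (\<Prod>s<n. p $ w s)"
proof -
  have "emeasure (coupon_space p) {\<omega>. \<forall>s<n. \<omega> s \<in> {w s}} = (\<Prod>s<n. ennreal (p $ w s))"
    unfolding emeasure_prefix_box by (simp add: emeasure_pmf_single pmf_coupon_pmf[OF assms])
  also have "\<dots> = ennreal (\<Prod>s<n. p $ w s)"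
    using assms by (intro prod_ennreal) (simp add: prob_vec_def)
  finally show ?thesis by simp
qed

text \<open>
  A function of the first \<open>n\<close> coupons is measurable because there are only finitely many words of
  length \<open>n\<close>.
\<close>

lemma measurable_prefix_dependent:
  fixes f :: "(nat \<Rightarrow> 'n::finite) \<Rightarrow> 'b"
  assumes f: "\<And>\<omega> \<omega>'. (\<And>s. s < n \<Longrightarrow> \<omega> s = \<omega>' s) \<Longrightarrow> f \<omega> = f \<omega>'"
  shows "f \<in> coupon_space p \<rightarrow>\<^sub>M count_space UNIV"
proof (rule measurableI)
  fix B :: "'b set"
  define W where "W = {w \<in> {..<n} \<rightarrow>\<^sub>E (UNIV :: 'n set). f w \<in> B}"
  have "f -` B = (\<Union>w\<in>W. {\<omega>. \<forall>s<n. \<omega> s \<in> {w s}})"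
  proof (intro set_eqI iffI)
    fix \<omega> assume \<omega>: "\<omega> \<in> f -` B"
    have "f (restrict \<omega> {..<n}) = f \<omega>"
      by (rule f) simp
    then have "restrict \<omega> {..<n} \<in> W"
      using \<omega> unfolding W_def by simp
    then show "\<omega> \<in> (\<Union>w\<in>W. {\<omega>. \<forall>s<n. \<omega> s \<in> {w s}})"
      by (rule UN_I) simp
  next
    fix \<omega> assume "\<omega> \<in> (\<Union>w\<in>W. {\<omega>. \<forall>s<n. \<omega> s \<in> {w s}})"
    then obtain w where w: "w \<in> W" "\<forall>s<n. \<omega> s = w s" by blast
    have "f \<omega> = f w"
      by (rule f) (use w(2) in blast)
    then show "\<omega> \<in> f -` B"
      using w(1) unfolding W_def by simp
  qed
  moreover have "finite W"
    unfolding W_def by (rule finite_subset[OF _ finite_PiE[of "{..<n}" "\<lambda>_. UNIV"]]) auto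
  then have "(\<Union>w\<in>W. {\<omega>. \<forall>s<n. \<omega> s \<in> {w s}}) \<in> sets (coupon_space p)"
    by (rule sets.finite_UN) (rule sets_prefix_box)
  ultimately show "f -` B \<inter> space (coupon_space p) \<in> sets (coupon_space p)"
    by simp
qed simp

text \<open>
  The coupon numbered \<open>n\<close> has type \<open>L\<close>, and the counts among the \<open>n\<close> coupons before it are
  prescribed by \<open>K\<close>. With \<open>K L = {0}\<close> and \<open>0 \<notin> K i\<close> for \<open>i \<noteq> L\<close> this says that the collection is completed
  by this coupon.
\<close>

definition completion_event :: "nat \<Rightarrow> 'n \<Rightarrow> ('n \<Rightarrow> nat set) \<Rightarrow> (nat \<Rightarrow> 'n) set" where
  "completion_event n L K = {\<omega>. \<omega> n = L \<and> (\<forall>i. card {s. s < n \<and> \<omega> s = i} \<in> K i)}"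

text \<open>
  The event is the disjoint union of the cylinders over the words of length \<open>n\<close> with the prescribed
  counts, followed by \<open>L\<close>; their weights are summed by \<open>sum_words_eq_egf\<close>.
\<close>

lemma
  fixes p :: "real ^ 'n"
  shows sets_completion_event: "completion_event n L K \<in> sets (coupon_space p)"
    and emeasure_completion_event: "prob_vec p \<Longrightarrow> emeasure (coupon_space p) (completion_event n L K)
       = ennreal (p $ L * (fact n * fps_nth (\<Prod>i\<in>UNIV. egf (K i) (p $ i)) n))"
proof -
  define cyl where "cyl = (\<lambda>w. {\<omega>. \<forall>s<Suc n. \<omega> s \<in> {(w(n := L)) s}})"
  have eq: "completion_event n L K = (\<Union>w\<in>words K UNIV {..<n}. cyl w)"
  proof (intro set_eqI iffI)
    fix \<omega> assume w: "\<omega> \<in> completion_event n L K"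
    have "{s \<in> {..<n}. restrict \<omega> {..<n} s = i} = {s. s < n \<and> \<omega> s = i}" for i
      by auto
    then have "restrict \<omega> {..<n} \<in> words K UNIV {..<n}"
      using w by (auto simp: completion_event_def words_def)
    moreover have "\<omega> \<in> cyl (restrict \<omega> {..<n})"
      using w by (auto simp: cyl_def completion_event_def)
    ultimately show "\<omega> \<in> (\<Union>w\<in>words K UNIV {..<n}. cyl w)" by blast
  next
    fix \<omega> assume "\<omega> \<in> (\<Union>w\<in>words K UNIV {..<n}. cyl w)"
    then obtain w where w: "w \<in> words K UNIV {..<n}" "\<And>s. s < n \<Longrightarrow> \<omega> s = w s" "\<omega> n = L"
      unfolding cyl_def by (auto simp: less_Suc_eq)
    have "{s. s < n \<and> \<omega> s = i} = {s \<in> {..<n}. w s = i}" for i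
      using w by auto
    then show "\<omega> \<in> completion_event n L K"
      using w by (auto simp: completion_event_def words_def)
  qed
  have fin: "finite (words K UNIV {..<n})"
    by (rule finite_words) auto
  have cyl: "cyl w \<in> sets (coupon_space p)" for w
    unfolding cyl_def by (rule sets_prefix_box)
  show "completion_event n L K \<in> sets (coupon_space p)"
    unfolding eq using fin cyl by (intro sets.finite_UN) auto
  assume p: "prob_vec p"
  have disj: "disjoint_family_on cyl (words K UNIV {..<n})"
    unfolding disjoint_family_on_def
  proof (intro ballI impI)
    fix v w assume vw: "v \<in> words K UNIV {..<n}" "w \<in> words K UNIV {..<n}" "v \<noteq> w"
    then obtain s where "v s \<noteq> w s" by auto
    moreover have "s < n"
      using vw calculation by (force simp: words_def PiE_iff extensional_def)
    ultimately show "cyl v \<inter> cyl w = {}"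
      unfolding cyl_def by (auto intro!: exI[of _ s] split: if_splits)
  qed
  have "emeasure (coupon_space p) (completion_event n L K)
      = (\<Sum>w\<in>words K UNIV {..<n}. emeasure (coupon_space p) (cyl w))"
    unfolding eq using fin cyl disj by (intro sum_emeasure[symmetric]) auto
  also have "\<dots> = (\<Sum>w\<in>words K UNIV {..<n}. ennreal (p $ L * (\<Prod>s<n. p $ w s)))"
  proof (intro sum.cong refl)
    fix w
    have "emeasure (coupon_space p) (cyl w) = ennreal (\<Prod>s<Suc n. p $ (w(n := L)) s)"
      using emeasure_prefix[OF p, where n = "Suc n" and w = "w(n := L)"]
      unfolding cyl_def by (simp only: singleton_iff)
    also have "(\<Prod>s<Suc n. p $ (w(n := L)) s) = p $ L * (\<Prod>s<n. p $ w s)"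
      by (simp add: mult.commute)
    finally show "emeasure (coupon_space p) (cyl w) = ennreal (p $ L * (\<Prod>s<n. p $ w s))" .
  qed
  also have "\<dots> = ennreal (\<Sum>w\<in>words K UNIV {..<n}. p $ L * (\<Prod>s<n. p $ w s))"
    using p by (intro sum_ennreal mult_nonneg_nonneg prod_nonneg) (auto simp: prob_vec_def)
  also have "(\<Sum>w\<in>words K UNIV {..<n}. p $ L * (\<Prod>s<n. p $ w s))
      = p $ L * (fact n * fps_nth (\<Prod>i\<in>UNIV. egf (K i) (p $ i)) n)"
    using sum_words_eq_egf[of "UNIV :: 'n set" "{..<n}" "\<lambda>i. p $ i" K]
    by (simp add: sum_distrib_left[symmetric])
  finally show "emeasure (coupon_space p) (completion_event n L K)
       = ennreal (p $ L * (fact n * fps_nth (\<Prod>i\<in>UNIV. egf (K i) (p $ i)) n))" .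
qed

text \<open>
  The first \<open>n\<close> coupons all miss the type \<open>c\<close> with probability \<open>(1 - p $ c) ^ n\<close>, which tends to \<open>0\<close>.
\<close>

lemma AE_surj_coupon_space:
  fixes p :: "real ^ 'n"
  assumes p: "prob_vec p" and pos: "\<And>i. 0 < p $ i"
  shows "AE \<omega> in coupon_space p. surj \<omega>"
proof -
  interpret prob_space "coupon_space p" by (rule prob_space_coupon_space)
  have "AE \<omega> in coupon_space p. \<exists>s. \<omega> s = c" for c
  proof -
    define r where "r = measure (measure_pmf (coupon_pmf p)) (- {c})"
    have "0 \<le> r" by (simp add: r_def)
    moreover have "r = 1 - p $ c"
      using measure_pmf.prob_compl[of "{c}" "coupon_pmf p"]
      by (simp add: r_def Compl_eq_Diff_UNIV measure_pmf_single pmf_coupon_pmf[OF p])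
    ultimately have r: "0 \<le> r" "r < 1"
      using pos[of c] by linarith+
    define Z :: "(nat \<Rightarrow> 'n) set" where "Z = (\<Inter>n. {\<omega>. \<forall>s<n. \<omega> s \<in> - {c}})"
    have Zm: "Z \<in> sets (coupon_space p)"
      unfolding Z_def by (intro sets.countable_INT' image_subsetI sets_prefix_box) simp_all
    have "emeasure (coupon_space p) Z \<le> ennreal (r ^ n)" for n
    proof -
      have "emeasure (coupon_space p) Z \<le> emeasure (coupon_space p) {\<omega>. \<forall>s<n. \<omega> s \<in> - {c}}"
        by (intro emeasure_mono sets_prefix_box) (auto simp: Z_def)
      also have "\<dots> = ennreal (r ^ n)"
        unfolding emeasure_prefix_box measure_pmf.emeasure_eq_measure r_def[symmetric]
        using r by (simp add: ennreal_power)
      finally show ?thesis .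
    qed
    moreover have "(\<lambda>n. ennreal (r ^ n)) \<longlonglongrightarrow> ennreal 0"
      using r by (intro tendsto_ennrealI LIMSEQ_realpow_zero)
    ultimately have "emeasure (coupon_space p) Z \<le> 0"
      by (intro LIMSEQ_le_const[of "\<lambda>n. ennreal (r ^ n)"]) auto
    then have "Z \<in> null_sets (coupon_space p)"
      using Zm by auto
    then show ?thesis
      by (rule AE_I') (auto simp: Z_def)
  qed
  then have "AE \<omega> in coupon_space p. \<forall>c. \<exists>s. \<omega> s = c"
    by (simp add: AE_all_countable)
  then show ?thesis
    by eventually_elim (auto simp: surj_def; metis)
qed

lemma measurable_stop_time [measurable]:
  "stop_time \<in> coupon_space (p :: real ^ 'n) \<rightarrow>\<^sub>M count_space UNIV"
  unfolding stop_time_def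
proof (rule measurable_Least)
  fix t
  show "(\<lambda>\<omega>. \<omega> ` {..<t} = UNIV) \<in> coupon_space p \<rightarrow>\<^sub>M count_space UNIV"
    by (rule measurable_prefix_dependent[of t]) (metis image_cong lessThan_iff)
qed

lemma albums_prefix: "(\<And>s. s < t \<Longrightarrow> \<omega> s = \<omega>' s) \<Longrightarrow> albums \<omega> t = albums \<omega>' t"
  by (induction t) (auto simp: Let_def)

lemma measurable_empty_spaces [measurable]:
  "empty_spaces j \<in> coupon_space (p :: real ^ 'n) \<rightarrow>\<^sub>M count_space UNIV"
  unfolding empty_spaces_def
proof (rule measurable_compose_countable[OF _ measurable_stop_time])
  fix t
  show "(\<lambda>\<omega>. card (- albums \<omega> t j)) \<in> coupon_space p \<rightarrow>\<^sub>M count_space UNIV"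
    by (rule measurable_prefix_dependent[of t]) (metis albums_prefix)
qed

section \<open>The binomial coefficient as a sum of events\<close>

definition profile :: "nat \<Rightarrow> 'n \<Rightarrow> 'n set \<Rightarrow> 'n \<Rightarrow> nat set" where
  "profile j L S i = (if i = L then {0} else if i \<in> S then {1..<j} else {1..})"

text \<open>
  At the stopping time the last type \<open>L\<close> has count one, so it leaves one of the empty spaces, and
  \<open>empty_spaces j \<omega> - 1\<close> counts the other types with count less than \<open>j\<close>. The binomial coefficient
  therefore counts the \<open>m\<close>-sets \<open>S\<close> of such types, and \<open>\<omega>\<close> lies in exactly one of the events for each
  such \<open>S\<close> and in none for other sets.
\<close>

lemma binomial_empty_spaces_eq:
  fixes \<omega> :: "nat \<Rightarrow> 'n::finite"
  assumes surj: "surj \<omega>" and j: "2 \<le> j"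
  shows "ennreal (real ((empty_spaces j \<omega> - 1) choose m)) =
    (\<Sum>n. \<Sum>S | card S = m. \<Sum>L\<in>- S. indicator (completion_event n L (profile j L S)) \<omega>)"
proof -
  define cnt where "cnt = (\<lambda>n c. card {s. s < n \<and> \<omega> s = c})"
  have cnt_Suc: "cnt (Suc n) c = (if \<omega> n = c then Suc (cnt n c) else cnt n c)" for n c
  proof -
    have "{s. s < Suc n \<and> \<omega> s = c} = (if \<omega> n = c then insert n {s. s < n \<and> \<omega> s = c} else {s. s < n \<and> \<omega> s = c})"
      by (auto simp: less_Suc_eq)
    then show ?thesis by (simp add: cnt_def)
  qed
  have cnt0: "cnt n c = 0 \<longleftrightarrow> c \<notin> \<omega> ` {..<n}" for n c
    by (auto simp: cnt_def)
  define T where "T = stop_time \<omega>"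
  have ex: "\<exists>t. \<omega> ` {..<t} = UNIV"
  proof -
    have "c \<in> \<omega> ` {..<Suc (Max (range (inv \<omega>)))}" for c
    proof (rule image_eqI[of _ _ "inv \<omega> c"])
      show "c = \<omega> (inv \<omega> c)" using surj by (simp add: surj_f_inv_f)
      have "inv \<omega> c \<le> Max (range (inv \<omega>))" by (intro Max_ge) auto
      then show "inv \<omega> c \<in> {..<Suc (Max (range (inv \<omega>)))}"
        by (simp only: lessThan_iff less_Suc_eq_le)
    qed
    then show ?thesis by blast
  qed
  have T: "\<omega> ` {..<T} = UNIV"
    unfolding T_def stop_time_def using ex by (rule LeastI_ex)
  have Tmin: "\<omega> ` {..<t} \<noteq> UNIV" if "t < T" for t
    using not_less_Least[of t "\<lambda>t. \<omega> ` {..<t} = UNIV"] that unfolding T_def stop_time_def by blast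
  \<comment> \<open>Coupons are numbered from \<open>0\<close>, so the last coupon drawn is the one numbered \<open>T - 1\<close>.\<close>
  obtain n0 where n0: "T = Suc n0"
    using T by (cases T) auto
  define L0 where "L0 = \<omega> n0"
  have L0: "cnt n0 c = 0 \<longleftrightarrow> c = L0" for c
  proof -
    have "insert L0 (\<omega> ` {..<n0}) = UNIV"
      using T unfolding n0 L0_def by (simp add: lessThan_Suc)
    moreover have "L0 \<notin> \<omega> ` {..<n0}"
      using Tmin[of n0] calculation by (auto simp: n0)
    ultimately show ?thesis
      unfolding cnt0 by auto
  qed
  have event: "\<omega> \<in> completion_event n L (profile j L S) \<longleftrightarrow>
      n = n0 \<and> L = L0 \<and> (\<forall>c\<in>S. cnt n0 c < j)" if LS: "L \<notin> S" for n L S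
  proof
    assume e: "\<omega> \<in> completion_event n L (profile j L S)"
    then have c: "\<omega> n = L" "\<And>i. cnt n i \<in> profile j L S i"
      by (auto simp: completion_event_def cnt_def)
    have z: "cnt n i = 0 \<longleftrightarrow> i = L" for i
      using c(2)[of i] by (auto simp: profile_def split: if_splits)
    have "\<omega> ` {..<n} \<noteq> UNIV"
      using z[of L] cnt0[of n L] by auto
    then have "n < T"
      using T by (metis image_mono lessThan_subset_iff not_le top.extremum_unique)
    moreover have "\<omega> ` {..<Suc n} = UNIV"
      using z cnt0[of n] c(1) by (auto simp: lessThan_Suc)
    then have "\<not> Suc n < T"
      using Tmin by blast
    ultimately have n: "n = n0" using n0 by simp
    then show "n = n0 \<and> L = L0 \<and> (\<forall>c\<in>S. cnt n0 c < j)"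
      using c LS by (auto simp: L0_def profile_def split: if_splits) (metis atLeastLessThan_iff)
  next
    assume few: "n = n0 \<and> L = L0 \<and> (\<forall>c\<in>S. cnt n0 c < j)"
    then have "cnt n i \<in> profile j L S i" for i
      using L0[of i] by (auto simp: profile_def Suc_le_eq)
    then show "\<omega> \<in> completion_event n L (profile j L S)"
      using few by (simp add: completion_event_def cnt_def L0_def)
  qed
  define Z where "Z = {c. c \<noteq> L0 \<and> cnt n0 c < j}"
  have Z: "{c. cnt T c < j} = insert L0 Z"
    using j L0[of L0] by (auto simp: n0 cnt_Suc Z_def L0_def[symmetric])
  have "empty_spaces j \<omega> = card {c. cnt T c < j}"
    using empty_spaces_eq_card[of j \<omega>] j by (simp add: T_def cnt_def)
  then have U: "empty_spaces j \<omega> - 1 = card Z"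
    unfolding Z by (simp add: Z_def)
  have inner: "(\<Sum>L\<in>- S. indicator (completion_event n L (profile j L S)) \<omega>)
      = (if n = n0 \<and> S \<subseteq> Z then 1 else 0 :: ennreal)" for n S
  proof -
    have "(\<Sum>L\<in>- S. indicator (completion_event n L (profile j L S)) \<omega>)
        = (\<Sum>L\<in>- S. if L = L0 then (if n = n0 \<and> (\<forall>c\<in>S. cnt n0 c < j) then 1 else 0) else 0 :: ennreal)"
      by (intro sum.cong refl) (auto simp: event indicator_def)
    also have "\<dots> = (if n = n0 \<and> S \<subseteq> Z then 1 else 0)"
      by (auto simp: Z_def)
    finally show ?thesis .
  qed
  have "(\<Sum>S | card S = m. if n = n0 \<and> S \<subseteq> Z then 1 else 0 :: ennreal)
      = (if n = n0 then of_nat (card Z choose m) else 0)" for n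
  proof (cases "n = n0")
    case True
    have "(\<Sum>S | card S = m. if S \<subseteq> Z then 1 else 0 :: ennreal) = (\<Sum>S | S \<subseteq> Z \<and> card S = m. 1)"
      by (intro sum.mono_neutral_cong_right) auto
    also have "\<dots> = of_nat (card Z choose m)"
      by (simp add: n_subsets)
    finally show ?thesis using True by simp
  qed simp
  then have "(\<Sum>n. \<Sum>S | card S = m. \<Sum>L\<in>- S. indicator (completion_event n L (profile j L S)) \<omega>)
      = (\<Sum>n. if n = n0 then of_nat (card Z choose m) else 0 :: ennreal)"
    unfolding inner by simp
  also have "\<dots> = of_nat (card Z choose m)"
    by (subst suminf_finite[of "{n0}"]) auto
  finally show ?thesis
    unfolding U by (simp add: ennreal_of_nat_eq_real_of_nat)
qed

section \<open>Poissonization\<close>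

text \<open>
  Let the coupons arrive at the times of a Poisson process of rate \<open>c\<close>. The arrival time of the coupon
  numbered \<open>n\<close> has an Erlang density, whose integral is \<open>1\<close>; inserting it into each summand and summing
  under the integral turns the coefficients \<open>fact n * fps_nth _ n\<close> into values of the generating
  function at \<open>c * t\<close>. Its factors, each multiplied by \<open>exp (- (r i * t))\<close>, are the probabilities for
  independent Poisson counts with means \<open>r i * t\<close>. The rate \<open>c\<close> is arbitrary, since the order of the
  coupons does not depend on the time scale.
\<close>

lemma emeasure_completion_event_eq_nn_integral:
  fixes p :: "real ^ 'n"
  assumes p: "prob_vec p" and c: "0 < c" and LS: "L \<notin> S"
  defines "r \<equiv> \<lambda>i. c * p $ i"
  shows "(\<Sum>n. emeasure (coupon_space p) (completion_event n L (profile j L S)))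
    = (\<integral>\<^sup>+t. ennreal ((\<Prod>i\<in>S. few j (r i * t)) * (r L * exp (- (r L * t)) * (\<Prod>i\<in>- S - {L}. seen (r i * t))))
          * indicator {0..} t \<partial>lborel)"
proof -
  define w where "w = fps_nth (\<Prod>i\<in>UNIV. egf (profile j L S i) (p $ i))"
  define e where "e = (\<lambda>x i. if i = L then 1 else if i \<in> S then \<Sum>k=1..<j. (p $ i * x) ^ k / fact k else exp (p $ i * x) - 1)"
  have pnn: "0 \<le> p $ i" for i using p by (simp add: prob_vec_def)
  have "(\<lambda>n. fps_nth (egf (profile j L S i) (p $ i)) n * x ^ n) sums e x i" for i x
    using egf_sums by (auto simp: profile_def[abs_def] e_def)
  moreover have "0 \<le> fps_nth (egf (profile j L S i) (p $ i)) n" for i n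
    using pnn by (simp add: egf_def)
  ultimately have w: "(\<lambda>n. w n * x ^ n) sums (\<Prod>i\<in>UNIV. e x i)" "0 \<le> w n" if "0 \<le> x" for x n
    unfolding w_def using that
    by (auto intro!: sums_fps_prod_nonneg[THEN conjunct1] sums_fps_prod_nonneg[THEN conjunct2, rule_format, of _ _ 0 "e 0"])
  have wnn: "0 \<le> w n" for n using w(2)[of 0] by simp
  have "(\<Sum>n. emeasure (coupon_space p) (completion_event n L (profile j L S)))
      = (\<Sum>n. \<integral>\<^sup>+t. ennreal (p $ L * (fact n * w n)) * ennreal (erlang_density n c t) \<partial>lborel)"
  proof (intro suminf_cong)
    fix n
    have "(\<integral>\<^sup>+t. ennreal (erlang_density n c t) \<partial>lborel) = 1"
      using nn_integral_erlang_ith_moment[OF c, of n 0] by simp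
    then show "emeasure (coupon_space p) (completion_event n L (profile j L S))
      = (\<integral>\<^sup>+t. ennreal (p $ L * (fact n * w n)) * ennreal (erlang_density n c t) \<partial>lborel)"
      by (simp add: emeasure_completion_event[OF p] w_def nn_integral_cmult)
  qed
  also have "\<dots> = (\<integral>\<^sup>+t. (\<Sum>n. ennreal (p $ L * (fact n * w n)) * ennreal (erlang_density n c t)) \<partial>lborel)"
    by (rule nn_integral_suminf[symmetric]) simp
  also have "\<dots> = (\<integral>\<^sup>+t. ennreal ((\<Prod>i\<in>S. few j (r i * t)) * (r L * exp (- (r L * t)) * (\<Prod>i\<in>- S - {L}. seen (r i * t))))
          * indicator {0..} t \<partial>lborel)"
  proof (rule nn_integral_cong)
    fix t :: real
    show "(\<Sum>n. ennreal (p $ L * (fact n * w n)) * ennreal (erlang_density n c t))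
       = ennreal ((\<Prod>i\<in>S. few j (r i * t)) * (r L * exp (- (r L * t)) * (\<Prod>i\<in>- S - {L}. seen (r i * t)))) * indicator {0..} t"
    proof (cases "t < 0")
      case True
      then show ?thesis by (simp add: erlang_density_def)
    next
      case False
      then have t: "0 \<le> t" by simp
      have "(\<Sum>n. ennreal (p $ L * (fact n * w n)) * ennreal (erlang_density n c t))
         = (\<Sum>n. ennreal (r L * exp (- (c * t)) * (w n * (c * t) ^ n)))"
      proof (intro suminf_cong)
        fix n
        have "ennreal (p $ L * (fact n * w n)) * ennreal (erlang_density n c t)
            = ennreal (p $ L * (fact n * w n) * erlang_density n c t)"
          using pnn wnn c by (simp add: ennreal_mult)
        also have "p $ L * (fact n * w n) * erlang_density n c t = r L * exp (- (c * t)) * (w n * (c * t) ^ n)"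
          using t by (simp add: erlang_density_def r_def power_mult_distrib)
        finally show "ennreal (p $ L * (fact n * w n)) * ennreal (erlang_density n c t)
          = ennreal (r L * exp (- (c * t)) * (w n * (c * t) ^ n))" .
      qed
      also have "\<dots> = ennreal (r L * exp (- (c * t)) * (\<Prod>i\<in>UNIV. e (c * t) i))"
        using c t pnn wnn
        by (intro suminf_ennreal_eq sums_mult w) (auto simp: r_def)
      also have "r L * exp (- (c * t)) * (\<Prod>i\<in>UNIV. e (c * t) i)
         = (\<Prod>i\<in>S. few j (r i * t)) * (r L * exp (- (r L * t)) * (\<Prod>i\<in>- S - {L}. seen (r i * t)))"
      proof -
        have "(\<Sum>i\<in>UNIV. r i * t) = c * t"
          using p by (simp add: r_def prob_vec_def sum_distrib_left[symmetric] sum_distrib_right[symmetric])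
        then have "exp (- (c * t)) = (\<Prod>i\<in>UNIV. exp (- (r i * t)))"
          by (simp add: exp_sum[symmetric] sum_negf)
        then have "exp (- (c * t)) * (\<Prod>i\<in>UNIV. e (c * t) i) = (\<Prod>i\<in>UNIV. exp (- (r i * t)) * e (c * t) i)"
          by (simp add: prod.distrib)
        also have "(UNIV :: 'n set) = S \<union> insert L (- S - {L})" using LS by auto
        also have "(\<Prod>i\<in>\<dots>. exp (- (r i * t)) * e (c * t) i)
            = (\<Prod>i\<in>S. exp (- (r i * t)) * e (c * t) i) * (exp (- (r L * t)) * e (c * t) L
                * (\<Prod>i\<in>- S - {L}. exp (- (r i * t)) * e (c * t) i))"
          using LS by (subst prod.union_disjoint) (auto simp del: insert_Diff_single)
        also have "(\<Prod>i\<in>S. exp (- (r i * t)) * e (c * t) i) = (\<Prod>i\<in>S. few j (r i * t))"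
          using LS by (intro prod.cong refl) (auto simp: e_def few_def r_def mult_ac)
        also have "(\<Prod>i\<in>- S - {L}. exp (- (r i * t)) * e (c * t) i) = (\<Prod>i\<in>- S - {L}. seen (r i * t))"
          by (intro prod.cong refl) (auto simp: e_def seen_def r_def mult_ac right_diff_distrib exp_minus_inverse exp_minus)
        finally show ?thesis
          by (simp add: e_def mult_ac)
      qed
      finally show ?thesis using t by simp
    qed
  qed
  finally show ?thesis .
qed

lemma continuous_on_collector_integrand: "continuous_on X (collector_integrand m j r)"
  unfolding collector_integrand_def[abs_def] by (intro continuous_intros)

lemma collector_integrand_nonneg:
  assumes "\<And>i. 0 \<le> r i" "0 \<le> t"
  shows "0 \<le> collector_integrand m j r t"
  unfolding collector_integrand_def dprod_def using assms
  by (intro sum_nonneg mult_nonneg_nonneg prod_nonneg) (auto simp: few_nonneg seen_def)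

text \<open>
  The expectation is the sum of the probabilities of the events in \<open>binomial_empty_spaces_eq\<close>, each of
  which is an integral by \<open>emeasure_completion_event_eq_nn_integral\<close>.
\<close>

lemma C_coef_eq_nn_integral:
  fixes p :: "real ^ 'n"
  assumes p: "prob_vec p" and pos: "\<And>i. 0 < p $ i" and c: "0 < c" and j: "2 \<le> j"
  shows "ennreal (C_coef m j p)
     = (\<integral>\<^sup>+t. ennreal (collector_integrand m j (\<lambda>i. c * p $ i) t) * indicator {0..} t \<partial>lborel)"
proof -
  interpret prob_space "coupon_space p" by (rule prob_space_coupon_space)
  have [measurable]: "completion_event n L K \<in> sets (coupon_space p)" for n L K
    by (rule sets_completion_event)
  define h where "h = (\<lambda>S L t. ennreal ((\<Prod>i\<in>S. few j (c * p $ i * t)) * (c * p $ L * exp (- (c * p $ L * t))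
     * (\<Prod>i\<in>- S - {L}. seen (c * p $ i * t)))) * indicator {0..} t)"
  have [measurable]: "h S L \<in> borel_measurable borel" for S L
    unfolding h_def few_def seen_def by measurable
  define V where "V = (\<lambda>\<omega> :: nat \<Rightarrow> 'n. real ((empty_spaces j \<omega> - 1) choose m))"
  have Vm: "V \<in> borel_measurable (coupon_space p)"
    unfolding V_def by (rule measurable_compose[OF measurable_empty_spaces]) simp
  have "empty_spaces j \<omega> - 1 \<le> CARD('n)" for \<omega> :: "nat \<Rightarrow> 'n"
    unfolding empty_spaces_def by (rule order.trans[OF diff_le_self card_mono]) auto
  then have bound: "V \<omega> \<le> real (CARD('n) choose m)" for \<omega>
    unfolding V_def by (intro of_nat_mono binomial_right_mono)
  have Vint: "integrable (coupon_space p) V"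
    using bound Vm by (intro integrable_const_bound[of _ "real (CARD('n) choose m)"]) (auto simp: V_def)
  have "ennreal (C_coef m j p) = (\<integral>\<^sup>+\<omega>. ennreal (V \<omega>) \<partial>coupon_space p)"
    unfolding C_coef_def V_def[symmetric] using Vint by (intro nn_integral_eq_integral[symmetric]) (auto simp: V_def)
  also have "\<dots> = (\<integral>\<^sup>+\<omega>. (\<Sum>n. \<Sum>S | card S = m. \<Sum>L\<in>- S. indicator (completion_event n L (profile j L S)) \<omega>) \<partial>coupon_space p)"
    unfolding V_def
    by (intro nn_integral_cong_AE eventually_mono[OF AE_surj_coupon_space[OF p pos]] binomial_empty_spaces_eq j)
  also have "\<dots> = (\<Sum>n. \<Sum>S | card S = m. \<Sum>L\<in>- S. emeasure (coupon_space p) (completion_event n L (profile j L S)))"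
    by (simp add: nn_integral_suminf nn_integral_sum)
  also have "\<dots> = (\<Sum>S | card S = m. \<Sum>L\<in>- S. \<Sum>n. emeasure (coupon_space p) (completion_event n L (profile j L S)))"
    by (simp add: suminf_sum)
  also have "\<dots> = (\<Sum>S | card S = m. \<Sum>L\<in>- S. \<integral>\<^sup>+t. h S L t \<partial>lborel)"
    unfolding h_def by (intro sum.cong refl emeasure_completion_event_eq_nn_integral p c) auto
  also have "\<dots> = (\<integral>\<^sup>+t. (\<Sum>S | card S = m. \<Sum>L\<in>- S. h S L t) \<partial>lborel)"
    by (simp add: nn_integral_sum)
  also have "\<dots> = (\<integral>\<^sup>+t. ennreal (collector_integrand m j (\<lambda>i. c * p $ i) t) * indicator {0..} t \<partial>lborel)"
  proof (intro nn_integral_cong)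
    fix t :: real
    have nn: "0 \<le> (\<Prod>i\<in>S. few j (c * p $ i * t)) * (c * p $ L * exp (- (c * p $ L * t)) * (\<Prod>i\<in>- S - {L}. seen (c * p $ i * t)))"
      if "0 \<le> t" for S L
    proof -
      have "0 \<le> c * p $ i * t" for i
        using pos[of i] c that by simp
      then show ?thesis
        using pos[of L] c by (intro mult_nonneg_nonneg prod_nonneg) (auto simp: few_nonneg seen_def)
    qed
    then show "(\<Sum>S | card S = m. \<Sum>L\<in>- S. h S L t)
        = ennreal (collector_integrand m j (\<lambda>i. c * p $ i) t) * indicator {0..} t"
      unfolding h_def
      by (cases "0 \<le> t") (simp_all add: collector_integrand_def dprod_def sum_distrib_left sum_ennreal sum_nonneg)
  qed
  finally show ?thesis .
qed

lemma C_coef_nonneg: "0 \<le> C_coef m j p"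
  unfolding C_coef_def by simp

text \<open>
  Integrals over bounded intervals can be differentiated in a parameter without a dominating
  function.
\<close>

lemma integral_tendsto_C_coef:
  fixes p :: "real ^ 'n"
  assumes p: "prob_vec p" and pos: "\<And>i. 0 < p $ i" and c: "0 < c" and j: "2 \<le> j"
  shows "((\<lambda>T. integral {0..T} (collector_integrand m j (\<lambda>i. c * p $ i))) \<longlongrightarrow> C_coef m j p) at_top"
proof -
  let ?h = "collector_integrand m j (\<lambda>i. c * p $ i)"
  have nn: "0 \<le> ?h t" if "0 \<le> t" for t
    using that pos c by (intro collector_integrand_nonneg) (auto intro: less_imp_le)
  have hm: "?h \<in> borel_measurable borel"
    by (intro borel_measurable_continuous_onI continuous_on_collector_integrand)
  have "(\<integral>\<^sup>+t. ennreal (indicator {0..} t *\<^sub>R ?h t) \<partial>lborel) = ennreal (C_coef m j p)"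
    unfolding C_coef_eq_nn_integral[OF p pos c j] by (intro nn_integral_cong) (auto simp: indicator_def)
  then have hb: "has_bochner_integral lborel (\<lambda>t. indicator {0..} t *\<^sub>R ?h t) (C_coef m j p)"
    using hm nn C_coef_nonneg by (intro has_bochner_integral_nn_integral) (auto simp: indicator_def)
  then have "((\<lambda>T. set_lebesgue_integral lborel {0..T} ?h) \<longlongrightarrow> set_lebesgue_integral lborel {0..} ?h) at_top"
    by (intro tendsto_set_lebesgue_integral_at_top) (auto simp: set_integrable_def has_bochner_integral_iff)
  moreover have "set_lebesgue_integral lborel {0..T} ?h = integral {0..T} ?h" for T
    by (intro set_borel_integral_eq_integral borel_integrable_compact[of "{0..T}", folded set_integrable_def])
      (auto intro: continuous_on_collector_integrand)
  ultimately show ?thesis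
    using hb by (simp add: set_lebesgue_integral_def has_bochner_integral_iff)
qed

section \<open>Monotonicity along the segment\<close>

theorem theorem5p3:
  fixes p :: "real ^ 'n" and j m :: nat
  assumes "2 \<le> CARD('n)"
    and "2 \<le> j"
    and "1 \<le> m" and "m \<le> CARD('n) - 1"
    and "prob_vec p" and "\<And>i. 0 < p $ i"
    and "p \<noteq> uniform_vec"
  shows "strict_antimono_on {0<..1}
           (\<lambda>\<theta>. C_coef m j (uniform_vec + \<theta> *\<^sub>R (p - uniform_vec)))"
proof (rule monotone_onI)
  fix \<theta>1 \<theta>2 :: real
  assume \<theta>: "\<theta>1 \<in> {0<..1}" "\<theta>2 \<in> {0<..1}" "\<theta>1 < \<theta>2"
  define N where "N = real CARD('n)"
  define P where "P = (\<lambda>\<theta>. uniform_vec + \<theta> *\<^sub>R (p - uniform_vec))"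
  \<comment> \<open>Chosen so that \<open>P \<theta> / \<theta>\<close> is \<open>p\<close> plus a constant: a smaller \<open>\<theta>\<close> adds more to all rates.\<close>
  define s where "s = (\<lambda>\<theta>. (1 - \<theta>) / (\<theta> * N))"
  have N: "0 < N" by (simp add: N_def)
  have P: "P \<theta> $ i = \<theta> * (p $ i + s \<theta>)" if "\<theta> \<in> {0<..1}" for \<theta> i
    using that N by (simp add: P_def s_def uniform_vec_def N_def[symmetric] field_simps)
  have s0: "0 \<le> s \<theta>" if "\<theta> \<in> {0<..1}" for \<theta>
    using that N by (simp add: s_def)
  have Ppos: "0 < P \<theta> $ i" if "\<theta> \<in> {0<..1}" for \<theta> i
    using that s0[OF that] assms(6)[of i] by (simp add: P[OF that])
  have Psum: "prob_vec (P \<theta>)" if "\<theta> \<in> {0<..1}" for \<theta>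
  proof -
    have "(\<Sum>i\<in>UNIV. P \<theta> $ i) = 1"
      using assms(5) N
      by (simp add: P_def uniform_vec_def prob_vec_def sum.distrib sum_subtractf sum_distrib_left[symmetric] N_def[symmetric])
    then show ?thesis
      using Ppos[OF that] by (auto simp: prob_vec_def intro: less_imp_le)
  qed
  have lim: "((\<lambda>T. integral {0..T} (collector_integrand m j (\<lambda>i. p $ i + s \<theta>))) \<longlongrightarrow> C_coef m j (P \<theta>)) at_top"
    if "\<theta> \<in> {0<..1}" for \<theta>
  proof -
    have "(\<lambda>i. 1 / \<theta> * P \<theta> $ i) = (\<lambda>i. p $ i + s \<theta>)"
      using that by (simp add: P[OF that])
    then show ?thesis
      using integral_tendsto_C_coef[OF Psum[OF that] Ppos[OF that], of "1 / \<theta>" j m] that assms(2) by simp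
  qed
  have s_less: "s \<theta>2 < s \<theta>1"
    using \<theta> N by (simp add: s_def divide_simps) (simp add: algebra_simps)
  \<comment> \<open>The uniform vector is the only constant probability vector.\<close>
  obtain a b where ab: "p $ a \<noteq> p $ b"
  proof (rule ccontr)
    assume "\<not> thesis"
    then have eq: "p $ i = p $ k" for i k using that by blast
    have "p $ i = 1 / N" for i
    proof -
      have "(\<Sum>k\<in>UNIV. p $ k) = N * p $ i"
        using eq by (subst sum.cong[OF refl, of _ _ "\<lambda>_. p $ i"]) (auto simp: N_def)
      then show ?thesis
        using assms(5) N by (simp add: prob_vec_def field_simps)
    qed
    then show False
      using assms(7) by (auto simp: vec_eq_iff uniform_vec_def N_def)
  qed
  have "m < CARD('n)" using assms(1,4) by linarith
  then obtain \<epsilon> where \<epsilon>: "0 < \<epsilon>" "\<And>T. 2 \<le> T \<Longrightarrow>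
      integral {0..T} (collector_integrand m j (\<lambda>i. p $ i + s \<theta>2)) + \<epsilon>
        \<le> integral {0..T} (collector_integrand m j (\<lambda>i. p $ i + s \<theta>1))"
    using integral_strict_increase[OF assms(3) _ assms(2,6) ab s0[OF \<theta>(2)] s_less] by blast
  have "C_coef m j (P \<theta>2) + \<epsilon> \<le> C_coef m j (P \<theta>1)"
    by (rule tendsto_le[OF _ lim[OF \<theta>(1)] tendsto_add[OF lim[OF \<theta>(2)] tendsto_const]])
       (auto intro!: eventually_mono[OF eventually_ge_at_top[of 2]] \<epsilon>)
  then show "C_coef m j (uniform_vec + \<theta>2 *\<^sub>R (p - uniform_vec)) < C_coef m j (uniform_vec + \<theta>1 *\<^sub>R (p - uniform_vec))"
    using \<epsilon>(1) unfolding P_def by simp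
qed

end
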